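(* Let $N\ge 1$, $D_1>0$, $D_2>0$, $0<p\le q$ with $pq>1$. Let $\mu$ and $\nu$ be Radon measures in $\mathbf{R}^N$ and let $0<T\le\infty$. Consider the system $$(\mathrm{S})\qquad \partial_t u=D_1\Delta u+v^p,\quad \partial_t v=D_2\Delta v+u^q,\quad u,v\ge 0\quad\text{in }\mathbf{R}^N\times(0,T),$$ the initial condition $$(\mathrm{I})\qquad (u(\cdot,0),v(\cdot,0))=(\mu,\nu)\quad\text{in }\mathbf{R}^N,$$ and the initial trace condition $$(\mathrm{Tr})\qquad \operatorname*{ess\,lim}_{t\to+0}\int_{\mathbf{R}^N}u(y,t)\phi(y)\,dy=\int_{\mathbf{R}^N}\phi\,d\mu,\quad \operatorname*{ess\,lim}_{t\to+0}\int_{\mathbf{R}^N}v(y,t)\phi(y)\,dy=\int_{\mathbf{R}^N}\phi\,d\nu\quad\text{for all }\phi\in C_0(\mathbf{R}^N).$$ (i) If $(u,v)$ is a solution to (S) with (I) in $\mathbf{R}^N\times(0,T)$, then (Tr) holds. (ii) If $(u,v)$ is a solution to (S) in $\mathbf{R}^N\times(0,T)$ and (Tr) holds, then $(u,v)$ is a solution to (S) with (I) in $\mathbf{R}^N\times(0,T)$.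
   Context: Radon measures are nonnegative. $C_0(\mathbf{R}^N)$ is the space of continuous functions with compact support. $\operatorname{ess\,lim}_{t\to+0}$ is the limit as $t\to+0$ outside a null set of times. Let $G(x,t)=(4\pi t)^{-N/2}\exp(-|x|^2/(4t))$; for a Radon measure $\mu$ set $[S(t)\mu](x)=\int_{\mathbf{R}^N}G(x-y,t)\,d\mu(y)$, and for a nonnegative measurable function $\mu$ set $[S(t)\mu](x)=\int_{\mathbf{R}^N}G(x-y,t)\mu(y)\,dy$. Definitions of solution. Let $(u,v)$ be a pair of nonnegative measurable functions in $\mathbf{R}^N\times(0,T)$. $(u,v)$ is a solution to (S) in $\mathbf{R}^N\times(0,T)$ if $u(x,t)<\infty$, $v(x,t)<\infty$ and $$u(x,t)=[S(D_1(t-\tau))u(\tau)](x)+\int_\tau^t[S(D_1(t-s))v(s)^p](x)\,ds,$$ $$v(x,t)=[S(D_2(t-\tau))v(\tau)](x)+\int_\tau^t[S(D_2(t-s))u(s)^q](x)\,ds$$ for almost all $x\in\mathbf{R}^N$ and $0<\tau<t<T$. $(u,v)$ is a solution to (S) with (I) in $\mathbf{R}^N\times(0,T)$ if $u(x,t)<\infty$, $v(x,t)<\infty$ and $$u(x,t)=[S(D_1t)\mu](x)+\int_0^t[S(D_1(t-s))v(s)^p](x)\,ds,$$ $$v(x,t)=[S(D_2t)\nu](x)+\int_0^t[S(D_2(t-s))u(s)^q](x)\,ds$$ for almost all $x\in\mathbf{R}^N$ and $0<t<T$. *)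

theory Defs
  imports "HOL-Analysis.Analysis"
begin

text \<open>
  Euclidean space of dimension \<open>N = CARD('n)\<close> is \<open>real ^ 'n\<close>. Nonnegative functions that may
  take the value infinity have values in \<open>ennreal\<close>; such a function on space-time is a curried
  total function \<open>u x t\<close> whose values for \<open>t\<close> outside \<open>(0, T)\<close> are never used. The final time
  \<open>T\<close> is an extended real, so \<open>T = \<infinity>\<close> is allowed. Measurable and null mean Lebesgue measurable
  and Lebesgue null.
\<close>

text \<open>
  Every Borel measure on \<open>real ^ 'n\<close> that is finite on compact sets is automatically inner and
  outer regular, so no regularity clause is needed.
\<close>
definition radon_measure :: "(real ^ 'n) measure \<Rightarrow> bool" where
  "radon_measure \<mu> \<longleftrightarrow> sets \<mu> = sets borel \<and> (\<forall>K. compact K \<longrightarrow> emeasure \<mu> K < \<infinity>)"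

definition compactly_supported_continuous :: "(real ^ 'n \<Rightarrow> real) set" where
  "compactly_supported_continuous =
     {\<phi>. continuous_on UNIV \<phi> \<and> compact (closure {x. \<phi> x \<noteq> 0})}"

definition heat_kernel :: "real ^ 'n \<Rightarrow> real \<Rightarrow> real" where
  "heat_kernel x t =
     (4 * pi * t) powr (- real CARD('n) / 2) * exp (- (norm x)\<^sup>2 / (4 * t))"

definition heat_measure :: "real \<Rightarrow> (real ^ 'n) measure \<Rightarrow> real ^ 'n \<Rightarrow> ennreal" where
  "heat_measure t \<mu> x = (\<integral>\<^sup>+ y. ennreal (heat_kernel (x - y) t) \<partial>\<mu>)"

definition heat_fun :: "real \<Rightarrow> (real ^ 'n \<Rightarrow> ennreal) \<Rightarrow> real ^ 'n \<Rightarrow> ennreal" where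
  "heat_fun t f x = (\<integral>\<^sup>+ y. ennreal (heat_kernel (x - y) t) * f y \<partial>lebesgue)"

text \<open>Real powers on \<open>[0, \<infinity>]\<close>, used only for positive exponents.\<close>
definition ennreal_powr :: "ennreal \<Rightarrow> real \<Rightarrow> ennreal" where
  "ennreal_powr a r = (if a = \<infinity> then \<infinity> else ennreal (enn2real a powr r))"

definition spacetime_measurable :: "ereal \<Rightarrow> (real ^ 'n \<Rightarrow> real \<Rightarrow> ennreal) \<Rightarrow> bool" where
  "spacetime_measurable T u \<longleftrightarrow>
     (\<lambda>(x, t). u x t) \<in> borel_measurable (lebesgue_on {(x, t). 0 < t \<and> ereal t < T})"

text \<open>
  Here ``for almost all \<open>x\<close> and \<open>0 < \<tau> < t < T\<close>'' refers to almost all triples \<open>(x, \<tau>, t)\<close>: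
  \<open>u\<close> and \<open>v\<close> are only measurable on space-time, so nothing is meaningful at every single time.
\<close>
definition solution_S ::
  "real \<Rightarrow> real \<Rightarrow> real \<Rightarrow> real \<Rightarrow> ereal \<Rightarrow>
   (real ^ 'n \<Rightarrow> real \<Rightarrow> ennreal) \<Rightarrow> (real ^ 'n \<Rightarrow> real \<Rightarrow> ennreal) \<Rightarrow> bool" where
  "solution_S D1 D2 p q T u v \<longleftrightarrow>
     spacetime_measurable T u \<and> spacetime_measurable T v \<and>
     (AE (x, \<tau>, t) in lebesgue. 0 < \<tau> \<and> \<tau> < t \<and> ereal t < T \<longrightarrow>
        u x t < \<infinity> \<and> v x t < \<infinity> \<and>
        u x t = heat_fun (D1 * (t - \<tau>)) (\<lambda>y. u y \<tau>) x
          + (\<integral>\<^sup>+ s\<in>{\<tau><..<t}. heat_fun (D1 * (t - s)) (\<lambda>y. ennreal_powr (v y s) p) x \<partial>lebesgue) \<and>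
        v x t = heat_fun (D2 * (t - \<tau>)) (\<lambda>y. v y \<tau>) x
          + (\<integral>\<^sup>+ s\<in>{\<tau><..<t}. heat_fun (D2 * (t - s)) (\<lambda>y. ennreal_powr (u y s) q) x \<partial>lebesgue))"

definition solution_S_with_I ::
  "real \<Rightarrow> real \<Rightarrow> real \<Rightarrow> real \<Rightarrow> ereal \<Rightarrow> (real ^ 'n) measure \<Rightarrow> (real ^ 'n) measure \<Rightarrow>
   (real ^ 'n \<Rightarrow> real \<Rightarrow> ennreal) \<Rightarrow> (real ^ 'n \<Rightarrow> real \<Rightarrow> ennreal) \<Rightarrow> bool" where
  "solution_S_with_I D1 D2 p q T \<mu> \<nu> u v \<longleftrightarrow>
     spacetime_measurable T u \<and> spacetime_measurable T v \<and>
     (AE (x, t) in lebesgue. 0 < t \<and> ereal t < T \<longrightarrow>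
        u x t < \<infinity> \<and> v x t < \<infinity> \<and>
        u x t = heat_measure (D1 * t) \<mu> x
          + (\<integral>\<^sup>+ s\<in>{0<..<t}. heat_fun (D1 * (t - s)) (\<lambda>y. ennreal_powr (v y s) p) x \<partial>lebesgue) \<and>
        v x t = heat_measure (D2 * t) \<nu> x
          + (\<integral>\<^sup>+ s\<in>{0<..<t}. heat_fun (D2 * (t - s)) (\<lambda>y. ennreal_powr (u y s) q) x \<partial>lebesgue))"

text \<open>
  The limit as \<open>t\<close> tends to \<open>0\<close> from the right, outside a null set \<open>Z\<close> of times. The first
  conjunct says that the integrals over space converge absolutely for small \<open>t\<close> outside \<open>Z\<close>;
  it is needed because \<open>enn2real \<infinity> = 0\<close> and non-convergent Bochner integrals are \<open>0\<close> by
  convention. Where it holds, \<open>u y t\<close> is finite for almost every \<open>y\<close> with \<open>\<phi> y \<noteq> 0\<close>.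
\<close>
definition has_initial_trace ::
  "(real ^ 'n \<Rightarrow> real \<Rightarrow> ennreal) \<Rightarrow> (real ^ 'n) measure \<Rightarrow> bool" where
  "has_initial_trace u \<mu> \<longleftrightarrow>
     (\<forall>\<phi>\<in>compactly_supported_continuous. \<exists>Z\<in>null_sets lebesgue.
        (\<forall>\<^sub>F t in at 0 within ({0<..} - Z).
           (\<integral>\<^sup>+ y. u y t * ennreal \<bar>\<phi> y\<bar> \<partial>lebesgue) < \<infinity>) \<and>
        ((\<lambda>t. \<integral>y. enn2real (u y t) * \<phi> y \<partial>lebesgue) \<longlongrightarrow> (\<integral>y. \<phi> y \<partial>\<mu>))
          (at 0 within ({0<..} - Z)))"

end

theory Submission
  imports Defs "HOL-Probability.Distributions" "HOL-Real_Asymp.Real_Asymp"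
begin

text \<open>
  The two equations are coupled only through their source terms. Once the source \<open>v\<^sup>p\<close> of the
  first equation is regarded as a given nonnegative measurable function \<open>f\<close>, the pair of claims
  about \<open>(u, \<mu>)\<close> becomes a statement about the linear equation
  \<open>\<partial>\<^sub>t u = D \<Delta>u + f\<close>, and likewise for \<open>(v, \<nu>)\<close> with source \<open>u\<^sup>q\<close>. It is therefore
  enough to prove two scalar results, \<open>mild_solution_initial_trace\<close> and
  \<open>mild_solution_of_initial_trace\<close>.

  \<^emph>\<open>From the formula to the trace.\<close> Integrate the representation of \<open>u(t)\<close> against a test
  function \<open>\<phi> \<ge> 0\<close> and move the heat semigroup onto \<open>\<phi>\<close> by Tonelli. The first term becomes the
  \<open>\<mu>\<close>-integral of \<open>S(Dt)\<phi>\<close>, which tends pointwise to \<open>\<phi>\<close>. A majorant comes from finiteness of the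
  solution at one single point \<open>(x\<^sub>0, t\<^sub>0)\<close>: a compactly supported \<open>\<phi>\<close> lies below a multiple of
  a narrow Gaussian, the semigroup keeps it below a slightly wider one, and every Gaussian that is
  narrow enough lies below a multiple of \<open>G(x\<^sub>0 - y, D t\<^sub>0)\<close> (\<open>heat_kernel_le_shifted\<close>), which is
  \<open>\<mu>\<close>-integrable. The same comparison bounds the contribution of the source by the
  part over \<open>0 < s < t\<close> of the finite Duhamel integral at \<open>(x\<^sub>0, t\<^sub>0)\<close>, and this part vanishes as
  \<open>t \<rightarrow> 0\<close>. The two limits are \<open>heat_measure_initial_trace\<close> and \<open>duhamel_initial_trace\<close>.

  \<^emph>\<open>From the trace to the formula.\<close> Fix a generic \<open>(x, t)\<close> and let \<open>\<tau> \<rightarrow> 0\<close> in the formula that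
  starts at time \<open>\<tau>\<close>. The Duhamel integral converges monotonically, so everything rests on
  \<open>S(D(t - \<tau>))u(\<tau>)(x) \<rightarrow> S(Dt)\<mu>(x)\<close>, where \<open>u(\<tau>) \<rightarrow> \<mu>\<close> is only known against compactly supported
  functions. The danger is mass escaping to infinity. It is excluded by using the formula
  once more at a slightly later generic time \<open>t' > t\<close>: it gives \<open>S(D(t' - \<tau>))u(\<tau>)(x) \<le> u(x, t') < \<infinity>\<close>
  for all small \<open>\<tau>\<close>, and far from \<open>x\<close> the kernel at time \<open>D t\<close> is arbitrarily small relative to the
  kernel at time \<open>D(t' - \<tau>)\<close>. This is \<open>heat_fun_tendsto_heat_measure\<close>.

  Since \<open>u\<close> and \<open>f\<close> are only Lebesgue measurable on space-time, they are replaced by Borel functions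
  that agree with them almost everywhere, so that Fubini's theorem applies to their time slices.
\<close>

section \<open>The heat kernel\<close>

lemma heat_kernel_nonneg [simp]: "0 \<le> heat_kernel x t"
  by (simp add: heat_kernel_def)

lemma heat_kernel_pos: "0 < t \<Longrightarrow> 0 < heat_kernel x t"
  by (simp add: heat_kernel_def)

lemma heat_kernel_commute: "heat_kernel (x - y) t = heat_kernel (y - x) t"
  by (simp add: heat_kernel_def norm_minus_commute)

lemma borel_measurable_heat_kernel [measurable]:
  fixes f :: "'a \<Rightarrow> real ^ 'n"
  assumes [measurable]: "f \<in> borel_measurable M" "g \<in> borel_measurable M"
  shows "(\<lambda>w. heat_kernel (f w) (g w)) \<in> borel_measurable M"
  unfolding heat_kernel_def by measurable

text \<open>
  All comparisons of the kernel at two times and the same point are read off from this ratio: on a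
  ball it is close to \<open>1\<close> when \<open>s\<close> is close to \<open>m\<close>, and for \<open>s < m\<close> it decays like a Gaussian.
\<close>
lemma heat_kernel_change_time:
  fixes z :: "real ^ 'n"
  assumes "0 < s" "0 < m"
  shows "heat_kernel z s =
    (m / s) powr (real CARD('n) / 2) * exp (- (norm z)\<^sup>2 / 4 * (1 / s - 1 / m)) * heat_kernel z m"
proof -
  have "(4 * pi * s) powr (- real CARD('n) / 2)
      = (m / s) powr (real CARD('n) / 2) * (4 * pi * m) powr (- real CARD('n) / 2)"
    using assms by (simp add: powr_mult powr_divide powr_minus field_simps)
  moreover have "exp (- (norm z)\<^sup>2 / (4 * s))
      = exp (- (norm z)\<^sup>2 / 4 * (1 / s - 1 / m)) * exp (- (norm z)\<^sup>2 / (4 * m))"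
    unfolding exp_add[symmetric] using assms by (simp add: field_simps)
  ultimately show ?thesis
    by (simp add: heat_kernel_def)
qed

text \<open>
  The squared distance satisfies \<open>|x - y|\<^sup>2 \<le> 2|x|\<^sup>2 + 2|y|\<^sup>2\<close>, so doubling the time absorbs a
  change of centre. The constant depends only on the bounds \<open>a0\<close> and \<open>b0\<close>, because the lemma is
  applied to whole families of times at once.
\<close>
lemma heat_kernel_le_shifted:
  fixes x y :: "real ^ 'n"
  assumes "0 < a0" "a0 \<le> a" "2 * a \<le> b" "b \<le> b0"
  shows "heat_kernel y a
    \<le> (b0 / a0) powr (real CARD('n) / 2) * exp ((norm x)\<^sup>2 / (4 * a0)) * heat_kernel (x - y) b"
proof -
  have pos: "0 < a" "0 < b" "0 < b0" using assms by auto
  have "norm (x - y) \<le> norm x + norm y" by (rule norm_triangle_ineq4)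
  then have "(norm (x - y))\<^sup>2 \<le> (norm x + norm y)\<^sup>2"
    by (intro power_mono) auto
  also have "\<dots> \<le> 2 * (norm x)\<^sup>2 + 2 * (norm y)\<^sup>2"
    using sum_squares_bound[of "norm x" "norm y"] by (simp add: power2_sum)
  finally have tri: "(norm (x - y))\<^sup>2 \<le> 2 * (norm x)\<^sup>2 + 2 * (norm y)\<^sup>2" .
  have "(norm (x - y))\<^sup>2 / (4 * b) \<le> (2 * (norm x)\<^sup>2 + 2 * (norm y)\<^sup>2) / (4 * b)"
    using tri pos by (intro divide_right_mono) auto
  also have "\<dots> \<le> (2 * (norm x)\<^sup>2 + 2 * (norm y)\<^sup>2) / (4 * (2 * a))"
    using pos assms by (intro divide_left_mono) auto
  also have "\<dots> = (norm x)\<^sup>2 / (4 * a) + (norm y)\<^sup>2 / (4 * a)"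
    using pos by (simp add: field_simps)
  also have "(norm x)\<^sup>2 / (4 * a) \<le> (norm x)\<^sup>2 / (4 * a0)"
    using pos assms by (intro divide_left_mono) auto
  finally have "- (norm y)\<^sup>2 / (4 * a) \<le> (norm x)\<^sup>2 / (4 * a0) + - (norm (x - y))\<^sup>2 / (4 * b)"
    by simp
  then have e: "exp (- (norm y)\<^sup>2 / (4 * a))
      \<le> exp ((norm x)\<^sup>2 / (4 * a0)) * exp (- (norm (x - y))\<^sup>2 / (4 * b))"
    unfolding exp_add[symmetric] by simp
  have "(4 * pi * a) powr (- real CARD('n) / 2)
      = (b / a) powr (real CARD('n) / 2) * (4 * pi * b) powr (- real CARD('n) / 2)"
    using pos by (simp add: powr_mult powr_divide powr_minus field_simps)
  also have "\<dots> \<le> (b0 / a0) powr (real CARD('n) / 2) * (4 * pi * b) powr (- real CARD('n) / 2)"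
    using pos assms by (intro mult_right_mono powr_mono2 frac_le) auto
  finally have c: "(4 * pi * a) powr (- real CARD('n) / 2)
      \<le> (b0 / a0) powr (real CARD('n) / 2) * (4 * pi * b) powr (- real CARD('n) / 2)" .
  show ?thesis
    using mult_mono[OF c e] by (simp add: heat_kernel_def ac_simps)
qed

text \<open>
  The kernel at time \<open>t\<close> is the density of a Gaussian vector with independent coordinates of
  variance \<open>2t\<close>; its total mass is thereby reduced to dimension one.
\<close>
lemma heat_kernel_eq_prod_normal_density:
  fixes x y :: "real ^ 'n"
  assumes "0 < t"
  shows "heat_kernel (x - y) t = (\<Prod>b\<in>Basis. normal_density (y \<bullet> b) (sqrt (2 * t)) (x \<bullet> b))"
proof -
  have "(\<Prod>b\<in>Basis. normal_density (y \<bullet> b) (sqrt (2 * t)) (x \<bullet> b))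
      = (\<Prod>b\<in>(Basis :: (real ^ 'n) set). 1 / sqrt (4 * pi * t))
        * (\<Prod>b\<in>Basis. exp (- (x \<bullet> b - y \<bullet> b)\<^sup>2 / (4 * t)))"
    using assms by (simp add: normal_density_def prod.distrib prod_dividef power_one_over mult_ac)
  also have "(\<Prod>b\<in>(Basis :: (real ^ 'n) set). 1 / sqrt (4 * pi * t)) = (1 / sqrt (4 * pi * t)) ^ CARD('n)"
    by simp
  also have "\<dots> = (4 * pi * t) powr (- real CARD('n) / 2)"
    using assms by (simp add: powr_half_sqrt[symmetric] powr_minus_divide power_one_over
        powr_realpow[symmetric] powr_powr divide_simps)
  also have "(\<Prod>b\<in>Basis. exp (- (x \<bullet> b - y \<bullet> b)\<^sup>2 / (4 * t)))
      = exp (\<Sum>b\<in>Basis. - (x \<bullet> b - y \<bullet> b)\<^sup>2 / (4 * t))"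
    by (simp add: exp_sum)
  also have "(\<Sum>b\<in>Basis. - (x \<bullet> b - y \<bullet> b)\<^sup>2 / (4 * t)) = - (norm (x - y))\<^sup>2 / (4 * t)"
  proof -
    have "(norm (x - y))\<^sup>2 = (x - y) \<bullet> (x - y)"
      by (rule power2_norm_eq_inner)
    also have "\<dots> = (\<Sum>b\<in>Basis. ((x - y) \<bullet> b) * ((x - y) \<bullet> b))"
      by (rule euclidean_inner)
    also have "\<dots> = (\<Sum>b\<in>Basis. (x \<bullet> b - y \<bullet> b)\<^sup>2)"
      by (simp only: inner_diff_left power2_eq_square)
    finally have "(norm (x - y))\<^sup>2 = (\<Sum>b\<in>Basis. (x \<bullet> b - y \<bullet> b)\<^sup>2)" .
    then show ?thesis
      by (simp only: sum_divide_distrib[symmetric] sum_negf)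
  qed
  finally show ?thesis
    by (simp add: heat_kernel_def)
qed

lemma nn_integral_heat_kernel:
  fixes y :: "real ^ 'n"
  assumes "0 < t"
  shows "(\<integral>\<^sup>+ x. ennreal (heat_kernel (x - y) t) \<partial>lborel) = 1"
proof -
  have one: "(\<integral>\<^sup>+ r. ennreal (normal_density c (sqrt (2 * t)) r) \<partial>lborel) = 1" for c
    using assms by (subst nn_integral_eq_integral) auto
  have "(\<integral>\<^sup>+ x. ennreal (heat_kernel (x - y) t) \<partial>lborel)
      = (\<integral>\<^sup>+ x. (\<Prod>b\<in>Basis. ennreal (normal_density (y \<bullet> b) (sqrt (2 * t)) (x \<bullet> b))) \<partial>lborel)"
    using assms by (simp add: heat_kernel_eq_prod_normal_density prod_ennreal)
  also have "\<dots> = (\<Prod>b\<in>(Basis :: (real ^ 'n) set).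
      \<integral>\<^sup>+ r. ennreal (normal_density (y \<bullet> b) (sqrt (2 * t)) r) \<partial>lborel)"
    by (rule nn_integral_lborel_prod) auto
  finally show ?thesis
    by (simp add: one)
qed

text \<open>
  Completing the square in \<open>x\<close>: as a function of \<open>x\<close> the product is again a multiple of a heat kernel.
  The semigroup law follows by integrating this identity.
\<close>
lemma heat_kernel_mult:
  fixes x y :: "real ^ 'n"
  assumes "0 < a" "0 < b"
  shows "heat_kernel (x - y) a * heat_kernel x b
    = heat_kernel y (a + b) * heat_kernel (x - (b / (a + b)) *\<^sub>R y) (a * b / (a + b))"
proof -
  define c where "c = a + b"
  have c: "0 < c" using assms by (simp add: c_def)
  have p: "(4 * pi * a) powr r * (4 * pi * b) powr r
      = (4 * pi * c) powr r * (4 * pi * (a * b / c)) powr r" for r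
  proof -
    have "(4 * pi * a) * (4 * pi * b) = (4 * pi * c) * (4 * pi * (a * b / c))"
      using c by simp
    then show ?thesis
      using assms c by (simp only: powr_mult[symmetric])
  qed
  have n: "(norm (x - y))\<^sup>2 / (4 * a) + (norm x)\<^sup>2 / (4 * b)
      = (norm y)\<^sup>2 / (4 * c) + (norm (x - (b / c) *\<^sub>R y))\<^sup>2 / (4 * (a * b / c))"
  proof -
    have "(norm (x - y))\<^sup>2 = x \<bullet> x - 2 * (x \<bullet> y) + y \<bullet> y"
      "(norm (x - (b / c) *\<^sub>R y))\<^sup>2 = x \<bullet> x - 2 * (b / c) * (x \<bullet> y) + (b / c)\<^sup>2 * (y \<bullet> y)"
      by (simp_all only: power2_norm_eq_inner inner_diff_left inner_diff_right inner_scaleR_left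
          inner_scaleR_right inner_commute[of y x])
        (simp_all add: power2_eq_square algebra_simps)
    moreover have "(X - 2 * Z + Y) / (4 * a) + X / (4 * b)
        = Y / (4 * c) + (X - 2 * (b / c) * Z + (b / c)\<^sup>2 * Y) / (4 * (a * b / c))" for X Y Z :: real
    proof -
      have "(X - 2 * (b / c) * Z + (b / c)\<^sup>2 * Y) / (4 * (a * b / c))
          = X * (c / (4 * a * b)) - Z / (2 * a) + Y * (b / (4 * a * c))"
        using assms c by (simp add: field_simps power2_eq_square)
      moreover have "c / (4 * a * b) = 1 / (4 * a) + 1 / (4 * b)"
        using assms by (simp add: c_def field_simps)
      moreover have "b / (4 * a * c) = 1 / (4 * a) - 1 / (4 * c)"
        using assms c by (simp add: c_def field_simps)
      ultimately show ?thesis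
        by (simp only:) (simp add: algebra_simps add_divide_distrib diff_divide_distrib)
    qed
    ultimately show ?thesis
      by (simp only: power2_norm_eq_inner[of x] power2_norm_eq_inner[of y])
  qed
  have e: "exp (- (norm (x - y))\<^sup>2 / (4 * a)) * exp (- (norm x)\<^sup>2 / (4 * b))
      = exp (- (norm y)\<^sup>2 / (4 * c)) * exp (- (norm (x - (b / c) *\<^sub>R y))\<^sup>2 / (4 * (a * b / c)))"
    unfolding exp_add[symmetric] using n by simp
  show ?thesis
    unfolding heat_kernel_def c_def[symmetric]
    using arg_cong2[where f = "(*)", OF p[of "- real CARD('n) / 2"] e] by (simp only: mult_ac)
qed

lemma heat_kernel_semigroup:
  fixes y :: "real ^ 'n"
  assumes "0 < a" "0 < b"
  shows "(\<integral>\<^sup>+ x. ennreal (heat_kernel (x - y) a) * ennreal (heat_kernel x b) \<partial>lborel)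
    = ennreal (heat_kernel y (a + b))"
proof -
  have "ennreal (heat_kernel (x - y) a) * ennreal (heat_kernel x b) = ennreal (heat_kernel y (a + b))
      * ennreal (heat_kernel (x - (b / (a + b)) *\<^sub>R y) (a * b / (a + b)))" for x
    by (simp only: ennreal_mult[OF heat_kernel_nonneg heat_kernel_nonneg, symmetric]
        heat_kernel_mult[OF assms])
  then show ?thesis
    using assms by (simp add: nn_integral_cmult nn_integral_heat_kernel)
qed

section \<open>Radon measures and test functions\<close>

lemma sigma_finite_radon_measure:
  fixes \<mu> :: "(real ^ 'n) measure"
  assumes "radon_measure \<mu>"
  shows "sigma_finite_measure \<mu>"
proof
  have sets: "sets \<mu> = sets borel" and fin: "\<And>K. compact K \<Longrightarrow> emeasure \<mu> K < \<infinity>"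
    using assms by (auto simp: radon_measure_def)
  have "(\<Union>n. cball 0 (real n)) = (UNIV :: (real ^ 'n) set)"
    by (auto simp: real_arch_simple)
  moreover have "emeasure \<mu> (cball 0 (real n)) \<noteq> \<infinity>" for n
    using fin[OF compact_cball, of 0 "real n"] by simp
  ultimately show "\<exists>A. countable A \<and> A \<subseteq> sets \<mu> \<and> \<Union> A = space \<mu> \<and> (\<forall>a\<in>A. emeasure \<mu> a \<noteq> \<infinity>)"
    using sets sets_eq_imp_space_eq[OF sets]
    by (intro exI[of _ "range (\<lambda>n. cball 0 (real n))"]) auto
qed

lemma borel_measurable_compactly_supported:
  assumes "\<phi> \<in> compactly_supported_continuous"
  shows "\<phi> \<in> borel_measurable borel"
  using assms by (auto simp: compactly_supported_continuous_def intro: borel_measurable_continuous_onI)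

lemma compactly_supported_compose:
  assumes "\<phi> \<in> compactly_supported_continuous" "continuous_on UNIV g" "g 0 = 0"
  shows "(\<lambda>x. g (\<phi> x)) \<in> compactly_supported_continuous"
proof -
  have "closure {x. g (\<phi> x) \<noteq> 0} \<subseteq> closure {x. \<phi> x \<noteq> 0}"
    using assms(3) by (intro closure_mono) auto
  then have "compact (closure {x. g (\<phi> x) \<noteq> 0})"
    using compact_Int_closed[of "closure {x. \<phi> x \<noteq> 0}" "closure {x. g (\<phi> x) \<noteq> 0}"] assms(1)
    by (simp add: compactly_supported_continuous_def inf.absorb2)
  moreover have "continuous_on UNIV (\<lambda>x. g (\<phi> x))"
    using assms(1,2) unfolding compactly_supported_continuous_def
    by (intro continuous_on_compose2[OF assms(2)]) auto
  ultimately show ?thesis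
    by (simp add: compactly_supported_continuous_def)
qed

lemma integrable_radon_compactly_supported:
  assumes \<mu>: "radon_measure \<mu>" and \<phi>: "\<phi> \<in> compactly_supported_continuous"
  shows "integrable \<mu> \<phi>"
proof -
  define K where "K = closure {x. \<phi> x \<noteq> 0}"
  have K: "compact K" and cont: "continuous_on UNIV \<phi>"
    using \<phi> by (auto simp: compactly_supported_continuous_def K_def)
  have sets[measurable_cong]: "sets \<mu> = sets borel" and fin: "emeasure \<mu> K < \<infinity>"
    using \<mu> K by (auto simp: radon_measure_def)
  have "bounded (\<phi> ` K)"
    by (intro compact_imp_bounded compact_continuous_image K continuous_on_subset[OF cont]) auto
  then obtain B where B: "\<And>x. x \<in> K \<Longrightarrow> norm (\<phi> x) \<le> B"
    by (auto simp: bounded_iff)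
  have "\<phi> x = 0" if "x \<notin> K" for x
    using that closure_subset[of "{x. \<phi> x \<noteq> 0}"] by (auto simp: K_def)
  then show ?thesis
    using K fin B borel_measurable_compactly_supported[OF \<phi>]
    by (intro integrableI_bounded_set[where A = K and B = B])
      (auto simp: sets compact_imp_closed measurable_cong_sets[OF sets refl])
qed

section \<open>Heat averages of test functions\<close>

lemma heat_fun_lborel:
  "heat_fun t f x = (\<integral>\<^sup>+ y. ennreal (heat_kernel (x - y) t) * f y \<partial>lborel)"
  by (simp add: heat_fun_def nn_integral_completion)

text \<open>
  A Gaussian is bounded below on the compact support of \<open>\<phi>\<close>. Bounding \<open>\<phi>\<close> by a Gaussian is
  convenient because the heat semigroup acts on Gaussians explicitly.
\<close>
lemma compactly_supported_le_heat_kernel: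
  fixes \<phi> :: "real ^ 'n \<Rightarrow> real"
  assumes "\<phi> \<in> compactly_supported_continuous" "0 < s"
  obtains C where "0 \<le> C" "\<And>x. \<bar>\<phi> x\<bar> \<le> C * heat_kernel x s"
proof -
  define K where "K = closure {x. \<phi> x \<noteq> 0}"
  have cont: "continuous_on UNIV \<phi>" and K: "compact K"
    using assms by (auto simp: compactly_supported_continuous_def K_def)
  have "continuous_on K (\<lambda>x. \<phi> x / heat_kernel x s)"
    using assms(2) heat_kernel_pos[of s] unfolding heat_kernel_def
    by (intro continuous_intros continuous_on_subset[OF cont]) auto
  then have "bounded ((\<lambda>x. \<phi> x / heat_kernel x s) ` K)"
    by (intro compact_imp_bounded compact_continuous_image K)
  then obtain C where C: "0 < C" "\<And>x. x \<in> K \<Longrightarrow> \<bar>\<phi> x / heat_kernel x s\<bar> \<le> C"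
    by (auto simp: bounded_pos)
  have "\<bar>\<phi> x\<bar> \<le> C * heat_kernel x s" for x
  proof (cases "x \<in> K")
    case True
    then show ?thesis
      using C(2)[of x] heat_kernel_pos[OF assms(2), of x] by (simp add: field_simps)
  next
    case False
    then have "\<phi> x = 0"
      using closure_subset[of "{x. \<phi> x \<noteq> 0}"] by (auto simp: K_def)
    then show ?thesis
      using C(1) by simp
  qed
  with C(1) show ?thesis
    by (intro that[of C]) auto
qed

lemma heat_fun_le_heat_kernel:
  fixes \<phi> :: "real ^ 'n \<Rightarrow> real"
  assumes "0 < t" "0 < s" "0 \<le> C" "\<And>x. \<phi> x \<le> C * heat_kernel x s"
  shows "heat_fun t (\<lambda>x. ennreal (\<phi> x)) y \<le> ennreal (C * heat_kernel y (t + s))"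
proof -
  have "heat_fun t (\<lambda>x. ennreal (\<phi> x)) y
      \<le> (\<integral>\<^sup>+ x. ennreal C * (ennreal (heat_kernel (x - y) t) * ennreal (heat_kernel x s)) \<partial>lborel)"
    unfolding heat_fun_lborel
  proof (rule nn_integral_mono)
    fix x
    have "ennreal (\<phi> x) \<le> ennreal C * ennreal (heat_kernel x s)"
      using assms(3,4) by (simp add: ennreal_mult[symmetric] ennreal_leI)
    then show "ennreal (heat_kernel (y - x) t) * ennreal (\<phi> x)
        \<le> ennreal C * (ennreal (heat_kernel (x - y) t) * ennreal (heat_kernel x s))"
      by (subst heat_kernel_commute) (metis mult.left_commute mult_left_mono zero_le)
  qed
  also have "\<dots> = ennreal C * ennreal (heat_kernel y (t + s))"
    using assms by (simp add: nn_integral_cmult heat_kernel_semigroup)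
  finally show ?thesis
    using assms by (simp add: ennreal_mult)
qed

text \<open>
  The heat kernel is an approximate identity. Mass at distance at least \<open>\<delta>\<close> from the centre is
  controlled by comparing the kernel at time \<open>t\<close> with the kernel at time \<open>2t\<close>: outside the ball
  their ratio is at most \<open>2\<^bsup>N/2\<^esup> exp (-\<delta>\<^sup>2 / (8t))\<close>, and the latter kernel has mass \<open>1\<close>.
\<close>
lemma heat_fun_tendsto:
  fixes \<phi> :: "real ^ 'n \<Rightarrow> real"
  assumes \<phi>[measurable]: "\<phi> \<in> borel_measurable borel" and cont: "isCont \<phi> y"
    and bnd: "\<And>x. 0 \<le> \<phi> x" "\<And>x. \<phi> x \<le> B"
  shows "((\<lambda>t. heat_fun t (\<lambda>x. ennreal (\<phi> x)) y) \<longlongrightarrow> ennreal (\<phi> y)) (at_right 0)"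
proof -
  define N where "N = real CARD('n)"
  define H where "H t = heat_fun t (\<lambda>x. ennreal (\<phi> x)) y" for t
  have B: "0 \<le> B" using bnd[of y] by simp
  have H: "H t = (\<integral>\<^sup>+ x. ennreal (heat_kernel (x - y) t) * ennreal (\<phi> x) \<partial>lborel)" for t
    by (simp add: H_def heat_fun_lborel heat_kernel_commute)
  have "\<forall>\<^sub>F t in at_right 0. H t \<noteq> \<infinity> \<and> \<bar>enn2real (H t) - \<phi> y\<bar> < e" if "0 < e" for e
  proof -
    obtain \<delta> where \<delta>: "0 < \<delta>" "\<And>x. norm (x - y) < \<delta> \<Longrightarrow> \<bar>\<phi> x - \<phi> y\<bar> < e / 2"
      using cont \<open>0 < e\<close> unfolding continuous_at_eps_delta by (metis dist_norm half_gt_zero real_norm_def)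
    \<comment> \<open>Bounds the part of the integral over the points at distance at least \<open>\<delta>\<close> from \<open>y\<close>.\<close>
    define b where "b t = B * (2 powr (N / 2) * exp (- \<delta>\<^sup>2 / 4 * (1 / (2 * t))))" for t
    have "((\<lambda>t. exp (- \<delta>\<^sup>2 / 4 * (1 / (2 * t)))) \<longlongrightarrow> 0) (at_right 0)"
      using \<delta>(1) by real_asymp
    then have "(b \<longlongrightarrow> B * (2 powr (N / 2) * 0)) (at_right 0)"
      unfolding b_def by (intro tendsto_intros)
    then have small: "\<forall>\<^sub>F t in at_right 0. b t < e / 2"
      using \<open>0 < e\<close> by (intro order_tendstoD(2)) auto
    have main: "H t \<le> ennreal (\<phi> y + e / 2 + b t) \<and> ennreal (\<phi> y) \<le> H t + ennreal (e / 2 + b t)"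
      if t: "0 < t" for t
    proof -
      have tail: "heat_kernel (x - y) t \<le> 2 powr (N / 2) * exp (- \<delta>\<^sup>2 / 4 * (1 / (2 * t))) * heat_kernel (x - y) (2 * t)"
        if "\<delta> \<le> norm (x - y)" for x
      proof -
        have "\<delta>\<^sup>2 \<le> (norm (x - y))\<^sup>2" using that \<delta>(1) by (intro power_mono) auto
        then have "exp (- (norm (x - y))\<^sup>2 / 4 * (1 / (2 * t))) \<le> exp (- \<delta>\<^sup>2 / 4 * (1 / (2 * t)))"
          using t by (simp add: divide_right_mono)
        moreover have "1 / t - 1 / (2 * t) = 1 / (2 * t)" using t by (simp add: field_simps)
        ultimately show ?thesis
          using t by (subst heat_kernel_change_time[of t "2 * t"])
            (auto simp: N_def intro!: mult_right_mono mult_left_mono)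
      qed
      have osc: "heat_kernel (x - y) t * \<bar>\<phi> x - \<phi> y\<bar>
          \<le> e / 2 * heat_kernel (x - y) t + b t * heat_kernel (x - y) (2 * t)" for x
      proof (cases "norm (x - y) < \<delta>")
        case True
        have "heat_kernel (x - y) t * \<bar>\<phi> x - \<phi> y\<bar> \<le> heat_kernel (x - y) t * (e / 2)"
          using \<delta>(2)[OF True] by (intro mult_left_mono) auto
        moreover have "0 \<le> b t * heat_kernel (x - y) (2 * t)"
          using B by (simp add: b_def)
        ultimately show ?thesis by (simp add: mult.commute)
      next
        case False
        have "\<bar>\<phi> x - \<phi> y\<bar> \<le> B" using bnd[of x] bnd[of y] by auto
        then have "heat_kernel (x - y) t * \<bar>\<phi> x - \<phi> y\<bar> \<le> 
            (2 powr (N / 2) * exp (- \<delta>\<^sup>2 / 4 * (1 / (2 * t))) * heat_kernel (x - y) (2 * t)) * B"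
          using tail[of x] False by (intro mult_mono) auto
        moreover have "0 \<le> e / 2 * heat_kernel (x - y) t"
          using \<open>0 < e\<close> by simp
        ultimately show ?thesis by (simp add: b_def mult_ac)
      qed
      have bt: "0 \<le> b t" using B by (simp add: b_def)
      have int: "(\<integral>\<^sup>+ x. ennreal (c * heat_kernel (x - y) t + d * heat_kernel (x - y) (2 * t)) \<partial>lborel) = ennreal (c + d)"
        if "0 \<le> c" "0 \<le> d" for c d
        using that t by (simp add: ennreal_mult nn_integral_add nn_integral_cmult nn_integral_heat_kernel)
      have "H t \<le> (\<integral>\<^sup>+ x. ennreal ((\<phi> y + e / 2) * heat_kernel (x - y) t + b t * heat_kernel (x - y) (2 * t)) \<partial>lborel)"
        unfolding H
      proof (rule nn_integral_mono)
        fix x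
        have "heat_kernel (x - y) t * \<phi> x \<le> heat_kernel (x - y) t * \<phi> y + heat_kernel (x - y) t * \<bar>\<phi> x - \<phi> y\<bar>"
          unfolding distrib_left[symmetric] by (intro mult_left_mono) auto
        with osc[of x] show "ennreal (heat_kernel (x - y) t) * ennreal (\<phi> x)
            \<le> ennreal ((\<phi> y + e / 2) * heat_kernel (x - y) t + b t * heat_kernel (x - y) (2 * t))"
          using bnd by (simp add: ennreal_mult[symmetric] algebra_simps ennreal_leI)
      qed
      also have "\<dots> = ennreal (\<phi> y + e / 2 + b t)"
        using bnd \<open>0 < e\<close> bt by (intro int) (auto simp: add_nonneg_nonneg)
      finally have 1: "H t \<le> ennreal (\<phi> y + e / 2 + b t)" .
      have "ennreal (\<phi> y) = (\<integral>\<^sup>+ x. ennreal (\<phi> y * heat_kernel (x - y) t + 0 * heat_kernel (x - y) (2 * t)) \<partial>lborel)"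
        using int[of "\<phi> y" 0] bnd by simp
      also have "\<dots> \<le> (\<integral>\<^sup>+ x. ennreal (heat_kernel (x - y) t) * ennreal (\<phi> x)
          + ennreal (e / 2 * heat_kernel (x - y) t + b t * heat_kernel (x - y) (2 * t)) \<partial>lborel)"
      proof (rule nn_integral_mono)
        fix x
        have "heat_kernel (x - y) t * \<phi> y \<le> heat_kernel (x - y) t * \<phi> x + heat_kernel (x - y) t * \<bar>\<phi> x - \<phi> y\<bar>"
          unfolding distrib_left[symmetric] by (intro mult_left_mono) auto
        with osc[of x] show "ennreal (\<phi> y * heat_kernel (x - y) t + 0 * heat_kernel (x - y) (2 * t))
            \<le> ennreal (heat_kernel (x - y) t) * ennreal (\<phi> x)
          + ennreal (e / 2 * heat_kernel (x - y) t + b t * heat_kernel (x - y) (2 * t))"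
          using bnd bt \<open>0 < e\<close>
          by (simp add: ennreal_mult[symmetric] ennreal_plus[symmetric] mult.commute ennreal_leI del: ennreal_plus)
      qed
      also have "\<dots> = H t + ennreal (e / 2 + b t)"
        using int[of "e / 2" "b t"] bt \<open>0 < e\<close>
        by (subst nn_integral_add) (simp_all only: H, auto)
      finally show ?thesis using 1 by simp
    qed
    have "\<forall>\<^sub>F t in at_right (0 :: real). 0 < t"
      by (simp add: eventually_at_right_less)
    with small show ?thesis
    proof eventually_elim
      case (elim t)
      have bt: "0 \<le> b t" using B by (simp add: b_def)
      from main[OF elim(2)] have fin: "H t \<noteq> \<infinity>"
        by (metis ennreal_less_top infinity_ennreal_def not_le)
      then obtain h where h: "H t = ennreal h" "0 \<le> h"
        by (cases "H t") auto
      from main[OF elim(2)] h have "h \<le> \<phi> y + e / 2 + b t" "\<phi> y \<le> h + (e / 2 + b t)"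
        using bnd bt \<open>0 < e\<close>
        by (auto simp: ennreal_plus[symmetric] add_nonneg_nonneg simp del: ennreal_plus)
      with elim(1) h fin show ?case by (auto simp: abs_less_iff)
    qed
  qed
  note ev = this
  have "((\<lambda>t. enn2real (H t)) \<longlongrightarrow> \<phi> y) (at_right 0)"
  proof (rule tendstoI)
    fix e :: real
    assume "0 < e"
    from ev[OF this] show "\<forall>\<^sub>F t in at_right 0. dist (enn2real (H t)) (\<phi> y) < e"
      by eventually_elim (simp add: dist_real_def)
  qed
  then have "((\<lambda>t. ennreal (enn2real (H t))) \<longlongrightarrow> ennreal (\<phi> y)) (at_right 0)"
    by (rule tendsto_ennrealI)
  moreover have "\<forall>\<^sub>F t in at_right 0. ennreal (enn2real (H t)) = H t"
    using ev[of 1] by (auto elim!: eventually_mono simp: less_top)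
  ultimately show ?thesis
    unfolding H_def[symmetric] using Lim_transform_eventually by blast
qed

section \<open>Initial traces of the free and of the forced part\<close>

text \<open>
  The heat semigroup is symmetric, so it may be moved from the measure to the test function.
\<close>
lemma nn_integral_heat_measure_mult:
  fixes \<mu> :: "(real ^ 'n) measure"
  assumes "radon_measure \<mu>" and [measurable]: "\<phi> \<in> borel_measurable borel"
  shows "(\<integral>\<^sup>+ x. heat_measure t \<mu> x * \<phi> x \<partial>lborel) = (\<integral>\<^sup>+ y. heat_fun t \<phi> y \<partial>\<mu>)"
proof -
  interpret \<mu>: sigma_finite_measure \<mu> by (rule sigma_finite_radon_measure) fact
  interpret pair_sigma_finite lborel \<mu> ..
  have [measurable_cong, simp]: "sets \<mu> = sets borel"
    using assms(1) by (simp add: radon_measure_def)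
  have "(\<integral>\<^sup>+ x. heat_measure t \<mu> x * \<phi> x \<partial>lborel)
      = (\<integral>\<^sup>+ x. \<integral>\<^sup>+ y. ennreal (heat_kernel (x - y) t) * \<phi> x \<partial>\<mu> \<partial>lborel)"
    unfolding heat_measure_def by (intro nn_integral_cong nn_integral_multc[symmetric]) measurable
  also have "\<dots> = (\<integral>\<^sup>+ y. \<integral>\<^sup>+ x. ennreal (heat_kernel (x - y) t) * \<phi> x \<partial>lborel \<partial>\<mu>)"
    by (rule Fubini'[symmetric]) measurable
  finally show ?thesis
    by (simp add: heat_fun_lborel heat_kernel_commute)
qed

lemma borel_measurable_heat_measure:
  fixes \<mu> :: "(real ^ 'n) measure"
  assumes "radon_measure \<mu>"
  shows "(\<lambda>(x, t). heat_measure (D * t) \<mu> x) \<in> borel_measurable (borel \<Otimes>\<^sub>M borel)"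
proof -
  interpret \<mu>: sigma_finite_measure \<mu> by (rule sigma_finite_radon_measure) fact
  have [measurable_cong]: "sets \<mu> = sets borel"
    using assms by (simp add: radon_measure_def)
  show ?thesis
    unfolding heat_measure_def by measurable
qed

text \<open>
  Dominated convergence with respect to \<open>\<mu>\<close>. The measure may be infinite, and the only growth
  information about it is the finiteness of its heat extension at \<open>(x0, t0)\<close>; the majorant is
  therefore a multiple of \<open>G(x0 - y, t0)\<close>.
\<close>
theorem heat_measure_initial_trace:
  fixes \<mu> :: "(real ^ 'n) measure" and \<phi> :: "real ^ 'n \<Rightarrow> real"
  assumes \<mu>: "radon_measure \<mu>" and \<phi>: "\<phi> \<in> compactly_supported_continuous" "\<And>x. 0 \<le> \<phi> x"
    and fin: "0 < t0" "heat_measure t0 \<mu> x0 < \<infinity>"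
  shows "((\<lambda>t. \<integral>\<^sup>+ x. heat_measure t \<mu> x * ennreal (\<phi> x) \<partial>lborel) \<longlongrightarrow> (\<integral>\<^sup>+ x. ennreal (\<phi> x) \<partial>\<mu>))
    (at_right 0)"
proof -
  \<comment> \<open>With \<open>t < s\<close> the Gaussian \<open>G(y, t + s)\<close> that bounds the evolved test function has time at most
      \<open>t0 / 2\<close>, as the comparison with \<open>G(x0 - y, t0)\<close> requires.\<close>
  define s where "s = t0 / 4"
  have s: "0 < s" using fin by (simp add: s_def)
  have [measurable_cong, simp]: "sets \<mu> = sets borel"
    using \<mu> by (simp add: radon_measure_def)
  note [measurable] = borel_measurable_compactly_supported[OF \<phi>(1)]
  obtain C where C: "0 \<le> C" "\<And>x. \<bar>\<phi> x\<bar> \<le> C * heat_kernel x s"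
    using compactly_supported_le_heat_kernel[OF \<phi>(1) s] by blast
  note C = C(1) abs_le_D1[OF C(2)]
  define K where "K = (t0 / s) powr (real CARD('n) / 2) * exp ((norm x0)\<^sup>2 / (4 * s))"
  have K: "0 \<le> K" by (simp add: K_def)
  have bnd: "heat_fun t (\<lambda>x. ennreal (\<phi> x)) y \<le> ennreal (C * K) * ennreal (heat_kernel (x0 - y) t0)"
    if t: "0 < t" "t < s" for t y
  proof -
    have "heat_kernel y (t + s) \<le> K * heat_kernel (x0 - y) t0"
      unfolding K_def using t by (intro heat_kernel_le_shifted) (auto simp: s_def)
    then have "C * heat_kernel y (t + s) \<le> C * (K * heat_kernel (x0 - y) t0)"
      using C by (intro mult_left_mono)
    with heat_fun_le_heat_kernel[of t s C \<phi> y] t s C show ?thesis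
      using K by (simp add: ennreal_mult[symmetric] mult.assoc)
        (meson ennreal_leI order_trans)
  qed
  have cont: "isCont \<phi> y" for y
    using \<phi>(1) by (simp add: compactly_supported_continuous_def continuous_on_eq_continuous_at)
  have "((\<lambda>t. \<integral>\<^sup>+ y. heat_fun t (\<lambda>x. ennreal (\<phi> x)) y \<partial>\<mu>) \<longlongrightarrow> (\<integral>\<^sup>+ x. ennreal (\<phi> x) \<partial>\<mu>)) (at_right 0)"
  proof (rule tendsto_at_right_sequentially[OF s])
    fix S :: "nat \<Rightarrow> real"
    assume S: "\<And>n. 0 < S n" "\<And>n. S n < s" "S \<longlonglongrightarrow> 0"
    have S0: "filterlim S (at_right 0) sequentially"
      using S by (intro tendsto_imp_filterlim_at_right) auto
    have "\<phi> x \<le> C * ((4 * pi * s) powr (- real CARD('n) / 2))" for x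
      by (rule order_trans[OF C(2)])
        (use C(1) s in \<open>auto simp: heat_kernel_def intro!: mult_left_mono mult_right_le_one_le\<close>)
    then have lim: "(\<lambda>n. heat_fun (S n) (\<lambda>x. ennreal (\<phi> x)) y) \<longlonglongrightarrow> ennreal (\<phi> y)" for y
      by (intro filterlim_compose[OF heat_fun_tendsto S0] cont \<phi>(2)) measurable
    show "(\<lambda>n. \<integral>\<^sup>+ y. heat_fun (S n) (\<lambda>x. ennreal (\<phi> x)) y \<partial>\<mu>) \<longlonglongrightarrow> (\<integral>\<^sup>+ x. ennreal (\<phi> x) \<partial>\<mu>)"
    proof (rule nn_integral_dominated_convergence[where w = "\<lambda>y. ennreal (C * K) * ennreal (heat_kernel (x0 - y) t0)"])
      show "(\<integral>\<^sup>+ y. ennreal (C * K) * ennreal (heat_kernel (x0 - y) t0) \<partial>\<mu>) < \<infinity>"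
        using fin(2) by (simp add: nn_integral_cmult heat_measure_def ennreal_mult_less_top)
    qed (use S bnd lim in \<open>auto simp: heat_fun_lborel\<close>)
  qed
  then show ?thesis
    by (simp add: nn_integral_heat_measure_mult[OF \<mu>])
qed

definition duhamel :: "real \<Rightarrow> (real ^ 'n \<Rightarrow> real \<Rightarrow> ennreal) \<Rightarrow> real \<Rightarrow> real \<Rightarrow> real ^ 'n \<Rightarrow> ennreal" where
  "duhamel D f \<tau> t x = (\<integral>\<^sup>+ s\<in>{\<tau><..<t}. heat_fun (D * (t - s)) (\<lambda>y. f y s) x \<partial>lborel)"

lemma borel_measurable_heat_fun [measurable]:
  fixes f :: "'a \<Rightarrow> real ^ 'n \<Rightarrow> ennreal" and x :: "'a \<Rightarrow> real ^ 'n"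
  assumes [measurable]: "t \<in> borel_measurable M" "x \<in> borel_measurable M"
    "(\<lambda>(w, y). f w y) \<in> borel_measurable (M \<Otimes>\<^sub>M borel)"
  shows "(\<lambda>w. heat_fun (t w) (f w) (x w)) \<in> borel_measurable M"
  unfolding heat_fun_lborel by measurable

lemma borel_measurable_duhamel:
  fixes f :: "real ^ 'n \<Rightarrow> real \<Rightarrow> ennreal"
  assumes [measurable]: "(\<lambda>(y, s). f y s) \<in> borel_measurable (borel \<Otimes>\<^sub>M borel)"
  shows "(\<lambda>(x, t). duhamel D f \<tau> t x) \<in> borel_measurable (borel \<Otimes>\<^sub>M borel)"
proof -
  have "duhamel D f \<tau> t x = (\<integral>\<^sup>+ s. (if \<tau> < s \<and> s < t then heat_fun (D * (t - s)) (\<lambda>y. f y s) x else 0) \<partial>lborel)"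
    for t x
    unfolding duhamel_def by (intro nn_integral_cong) auto
  then show ?thesis
    by simp
qed

lemma nn_integral_duhamel_mult:
  fixes f :: "real ^ 'n \<Rightarrow> real \<Rightarrow> ennreal"
  assumes [measurable]: "(\<lambda>(y, s). f y s) \<in> borel_measurable (borel \<Otimes>\<^sub>M borel)"
    "\<phi> \<in> borel_measurable borel"
  shows "(\<integral>\<^sup>+ x. duhamel D f \<tau> t x * \<phi> x \<partial>lborel)
    = (\<integral>\<^sup>+ s\<in>{\<tau><..<t}. (\<integral>\<^sup>+ y. heat_fun (D * (t - s)) \<phi> y * f y s \<partial>lborel) \<partial>lborel)"
proof -
  let ?i = "\<lambda>s. indicator {\<tau><..<t} s :: ennreal"
  let ?G = "\<lambda>x y s. ennreal (heat_kernel (x - y) (D * (t - s)))"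
  have "(\<integral>\<^sup>+ x. duhamel D f \<tau> t x * \<phi> x \<partial>lborel)
      = (\<integral>\<^sup>+ x. \<integral>\<^sup>+ s. (\<integral>\<^sup>+ y. ?G x y s * f y s \<partial>lborel) * ?i s * \<phi> x \<partial>lborel \<partial>lborel)"
    unfolding duhamel_def heat_fun_lborel
    by (intro nn_integral_cong nn_integral_multc[symmetric]) measurable
  also have "\<dots> = (\<integral>\<^sup>+ s. \<integral>\<^sup>+ x. (\<integral>\<^sup>+ y. ?G x y s * f y s \<partial>lborel) * ?i s * \<phi> x \<partial>lborel \<partial>lborel)"
    by (rule lborel_pair.Fubini') measurable
  also have "\<dots> = (\<integral>\<^sup>+ s. \<integral>\<^sup>+ x. \<integral>\<^sup>+ y. ?G x y s * f y s * ?i s * \<phi> x \<partial>lborel \<partial>lborel \<partial>lborel)"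
    by (intro nn_integral_cong) (simp add: nn_integral_multc)
  also have "\<dots> = (\<integral>\<^sup>+ s. \<integral>\<^sup>+ y. \<integral>\<^sup>+ x. ?G x y s * f y s * ?i s * \<phi> x \<partial>lborel \<partial>lborel \<partial>lborel)"
    by (intro nn_integral_cong lborel_pair.Fubini'[symmetric]) measurable
  also have "\<dots> = (\<integral>\<^sup>+ s. \<integral>\<^sup>+ y. (\<integral>\<^sup>+ x. ?G y x s * \<phi> x \<partial>lborel) * f y s * ?i s \<partial>lborel \<partial>lborel)"
  proof (intro nn_integral_cong)
    fix s y
    have "(\<integral>\<^sup>+ x. ?G x y s * f y s * ?i s * \<phi> x \<partial>lborel)
        = (\<integral>\<^sup>+ x. ?G y x s * \<phi> x * (f y s * ?i s) \<partial>lborel)"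
      by (intro nn_integral_cong) (subst heat_kernel_commute, simp only: mult_ac)
    also have "\<dots> = (\<integral>\<^sup>+ x. ?G y x s * \<phi> x \<partial>lborel) * (f y s * ?i s)"
      by (rule nn_integral_multc) measurable
    finally show "(\<integral>\<^sup>+ x. ?G x y s * f y s * ?i s * \<phi> x \<partial>lborel)
        = (\<integral>\<^sup>+ x. ?G y x s * \<phi> x \<partial>lborel) * f y s * ?i s"
      by (simp only: mult.assoc)
  qed
  finally show ?thesis
    by (simp add: heat_fun_lborel nn_integral_multc)
qed

lemma nn_integral_initial_interval_tendsto_0:
  fixes h :: "real \<Rightarrow> ennreal"
  assumes [measurable]: "h \<in> borel_measurable borel" and "0 < t0" "(\<integral>\<^sup>+ s\<in>{0<..<t0}. h s \<partial>lborel) < \<infinity>"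
  shows "((\<lambda>t. \<integral>\<^sup>+ s\<in>{0<..<t}. h s \<partial>lborel) \<longlongrightarrow> 0) (at_right 0)"
proof (rule tendsto_at_right_sequentially[OF \<open>0 < t0\<close>])
  fix S :: "nat \<Rightarrow> real"
  assume S: "\<And>n. 0 < S n" "\<And>n. S n < t0" "S \<longlonglongrightarrow> 0"
  have "(\<lambda>n. h s * indicator {0<..<S n} s) \<longlonglongrightarrow> 0" for s
  proof (rule tendsto_eventually)
    show "\<forall>\<^sub>F n in sequentially. h s * indicator {0<..<S n} s = 0"
    proof (cases "0 < s")
      case True
      show ?thesis
        using order_tendstoD(2)[OF S(3) True] by eventually_elim simp
    qed auto
  qed
  moreover have "h s * indicator {0<..<S n} s \<le> h s * indicator {0<..<t0} s" for s n
    using S(2)[of n] by (auto simp: indicator_def)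
  ultimately have "(\<lambda>n. \<integral>\<^sup>+ s\<in>{0<..<S n}. h s \<partial>lborel) \<longlonglongrightarrow> (\<integral>\<^sup>+ s. 0 \<partial>(lborel :: real measure))"
    using assms(3)
    by (intro nn_integral_dominated_convergence[where w = "\<lambda>s. h s * indicator {0<..<t0} s"]) auto
  then show "(\<lambda>n. \<integral>\<^sup>+ s\<in>{0<..<S n}. h s \<partial>lborel) \<longlonglongrightarrow> 0"
    by simp
qed

text \<open>
  After moving the semigroup onto \<open>\<phi>\<close>, the source at time \<open>s\<close> is weighted by at most a multiple of
  \<open>G(x0 - y, D(t0 - s))\<close>, uniformly in \<open>0 < s < t\<close> and in small \<open>t\<close>. What remains is the part over
  \<open>0 < s < t\<close> of a convergent integral.
\<close>
theorem duhamel_initial_trace: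
  fixes f :: "real ^ 'n \<Rightarrow> real \<Rightarrow> ennreal" and \<phi> :: "real ^ 'n \<Rightarrow> real"
  assumes f[measurable]: "(\<lambda>(y, s). f y s) \<in> borel_measurable (borel \<Otimes>\<^sub>M borel)"
    and \<phi>: "\<phi> \<in> compactly_supported_continuous" and "0 < D"
    and fin: "0 < t0" "duhamel D f 0 t0 x0 < \<infinity>"
  shows "((\<lambda>t. \<integral>\<^sup>+ x. duhamel D f 0 t x * ennreal (\<phi> x) \<partial>lborel) \<longlongrightarrow> 0) (at_right 0)"
proof -
  \<comment> \<open>Chosen such that \<open>2 (D (t - s) + s0) \<le> D (t0 - s)\<close> whenever \<open>0 < s < t < t0 / 4\<close>.\<close>
  define s0 where "s0 = D * t0 / 8"
  have s0: "0 < s0" using fin \<open>0 < D\<close> by (simp add: s0_def)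
  note [measurable] = borel_measurable_compactly_supported[OF \<phi>]
  obtain C where C: "0 \<le> C" "\<And>x. \<bar>\<phi> x\<bar> \<le> C * heat_kernel x s0"
    using compactly_supported_le_heat_kernel[OF \<phi> s0] by blast
  note C = C(1) abs_le_D1[OF C(2)]
  define K where "K = (D * t0 / s0) powr (real CARD('n) / 2) * exp ((norm x0)\<^sup>2 / (4 * s0))"
  have K: "0 \<le> K" by (simp add: K_def)
  define h where "h s = heat_fun (D * (t0 - s)) (\<lambda>y. f y s) x0" for s
  have [measurable]: "h \<in> borel_measurable borel"
    unfolding h_def by measurable
  have bnd: "(\<integral>\<^sup>+ x. duhamel D f 0 t x * ennreal (\<phi> x) \<partial>lborel)
      \<le> ennreal (C * K) * (\<integral>\<^sup>+ s\<in>{0<..<t}. h s \<partial>lborel)" if t: "0 < t" "t < t0 / 4" for t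
  proof -
    have pt: "heat_fun (D * (t - s)) (\<lambda>x. ennreal (\<phi> x)) y
        \<le> ennreal (C * K) * ennreal (heat_kernel (x0 - y) (D * (t0 - s)))" if "0 < s" "s < t" for s y
    proof -
      have "D * t \<le> D * (t0 / 4)" "D * s \<le> D * (t0 / 4)" "D * s \<le> D * t" "0 \<le> D * s"
        using t that \<open>0 < D\<close> by (auto intro!: mult_left_mono)
      then have "heat_kernel y (D * (t - s) + s0) \<le> K * heat_kernel (x0 - y) (D * (t0 - s))"
        unfolding K_def using t that s0
        by (intro heat_kernel_le_shifted) (auto simp: s0_def right_diff_distrib)
      then have "C * heat_kernel y (D * (t - s) + s0) \<le> C * (K * heat_kernel (x0 - y) (D * (t0 - s)))"
        using C by (intro mult_left_mono)
      with heat_fun_le_heat_kernel[of "D * (t - s)" s0 C \<phi> y] that s0 C \<open>0 < D\<close> show ?thesis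
        using K by (simp add: ennreal_mult[symmetric] mult.assoc)
          (meson ennreal_leI order_trans)
    qed
    have "(\<integral>\<^sup>+ x. duhamel D f 0 t x * ennreal (\<phi> x) \<partial>lborel)
      = (\<integral>\<^sup>+ s\<in>{0<..<t}. (\<integral>\<^sup>+ y. heat_fun (D * (t - s)) (\<lambda>x. ennreal (\<phi> x)) y * f y s \<partial>lborel) \<partial>lborel)"
      by (rule nn_integral_duhamel_mult) measurable
    also have "\<dots> \<le> (\<integral>\<^sup>+ s\<in>{0<..<t}. (ennreal (C * K) * h s) \<partial>lborel)"
    proof (rule nn_integral_mono)
      fix s
      have "(\<integral>\<^sup>+ y. heat_fun (D * (t - s)) (\<lambda>x. ennreal (\<phi> x)) y * f y s \<partial>lborel) \<le> ennreal (C * K) * h s"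
        if "0 < s" "s < t"
      proof -
        have "(\<integral>\<^sup>+ y. heat_fun (D * (t - s)) (\<lambda>x. ennreal (\<phi> x)) y * f y s \<partial>lborel)
          \<le> (\<integral>\<^sup>+ y. ennreal (C * K) * (ennreal (heat_kernel (x0 - y) (D * (t0 - s))) * f y s) \<partial>lborel)"
          by (intro nn_integral_mono) (simp add: mult.assoc[symmetric] mult_right_mono pt[OF that])
        then show ?thesis
          by (simp add: nn_integral_cmult h_def heat_fun_lborel)
      qed
      then show "(\<integral>\<^sup>+ y. heat_fun (D * (t - s)) (\<lambda>x. ennreal (\<phi> x)) y * f y s \<partial>lborel) * indicator {0<..<t} s
          \<le> ennreal (C * K) * h s * indicator {0<..<t} s"
        by (simp add: indicator_def)
    qed
    also have "\<dots> = ennreal (C * K) * (\<integral>\<^sup>+ s\<in>{0<..<t}. h s \<partial>lborel)"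
      by (subst nn_integral_cmult[symmetric]) (auto simp: mult.assoc)
    finally show ?thesis .
  qed
  have "((\<lambda>t. ennreal (C * K) * (\<integral>\<^sup>+ s\<in>{0<..<t}. h s \<partial>lborel)) \<longlongrightarrow> ennreal (C * K) * 0) (at_right 0)"
    using fin by (intro tendsto_mult_ennreal tendsto_const nn_integral_initial_interval_tendsto_0[of _ t0])
      (auto simp: duhamel_def h_def)
  then have lim: "((\<lambda>t. ennreal (C * K) * (\<integral>\<^sup>+ s\<in>{0<..<t}. h s \<partial>lborel)) \<longlongrightarrow> 0) (at_right 0)"
    by simp
  have "\<forall>\<^sub>F t in at_right 0. (\<integral>\<^sup>+ x. duhamel D f 0 t x * ennreal (\<phi> x) \<partial>lborel)
      \<le> ennreal (C * K) * (\<integral>\<^sup>+ s\<in>{0<..<t}. h s \<partial>lborel)"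
    using fin(1) by (intro eventually_at_rightI[of 0 "t0 / 4"] bnd) auto
  then show ?thesis
    by (intro tendsto_sandwich[OF _ _ tendsto_const lim]) auto
qed

section \<open>Passing to the limit in the initial data\<close>

definition cutoff :: "real \<Rightarrow> real ^ 'n \<Rightarrow> real" where
  "cutoff R z = max 0 (min 1 (R + 1 - norm z))"

lemma cutoff_bounds: "0 \<le> cutoff R z" "cutoff R z \<le> 1"
  and cutoff_eq_1: "norm z \<le> R \<Longrightarrow> cutoff R z = 1"
  and cutoff_eq_0: "R + 1 \<le> norm z \<Longrightarrow> cutoff R z = 0"
  by (auto simp: cutoff_def)

lemma borel_measurable_cutoff [measurable]: "cutoff R \<in> borel_measurable borel"
  unfolding cutoff_def by measurable

lemma cutoff_heat_kernel_compactly_supported: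
  fixes x :: "real ^ 'n"
  assumes "0 < s"
  shows "(\<lambda>y. cutoff R (x - y) * heat_kernel (x - y) s) \<in> compactly_supported_continuous"
proof -
  have "{y. cutoff R (x - y) * heat_kernel (x - y) s \<noteq> 0} \<subseteq> cball x (R + 1)"
    using cutoff_eq_0[of R "x - _"] by (auto simp: dist_norm not_le intro: ccontr less_imp_le)
  then have "closure {y. cutoff R (x - y) * heat_kernel (x - y) s \<noteq> 0} \<subseteq> cball x (R + 1)"
    by (simp add: closure_minimal)
  then have "compact (closure {y. cutoff R (x - y) * heat_kernel (x - y) s \<noteq> 0})"
    by (meson bounded_cball bounded_subset closed_closure compact_eq_bounded_closed)
  moreover have "continuous_on UNIV (\<lambda>y. cutoff R (x - y) * heat_kernel (x - y) s)"
    using assms unfolding cutoff_def heat_kernel_def by (intro continuous_intros) auto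
  ultimately show ?thesis
    by (simp add: compactly_supported_continuous_def)
qed

lemma nn_integral_cutoff_heat_kernel_tendsto:
  fixes \<mu> :: "(real ^ 'n) measure"
  assumes [measurable_cong]: "sets \<mu> = sets borel"
  shows "(\<lambda>R. \<integral>\<^sup>+ y. ennreal (cutoff (real R) (x - y) * heat_kernel (x - y) s) \<partial>\<mu>)
    \<longlonglongrightarrow> heat_measure s \<mu> x"
  unfolding heat_measure_def
proof (rule nn_integral_LIMSEQ)
  show "incseq (\<lambda>R y. ennreal (cutoff (real R) (x - y) * heat_kernel (x - y) s))"
    by (intro monoI le_funI ennreal_leI mult_right_mono) (auto simp: cutoff_def)
  fix y
  have "\<forall>\<^sub>F R in sequentially. cutoff (real R) (x - y) = 1"
    using eventually_ge_at_top[of "nat \<lceil>norm (x - y)\<rceil>"]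
    by eventually_elim (intro cutoff_eq_1, linarith)
  then show "(\<lambda>R. ennreal (cutoff (real R) (x - y) * heat_kernel (x - y) s)) \<longlonglongrightarrow> ennreal (heat_kernel (x - y) s)"
    by (intro tendsto_eventually) (auto elim: eventually_mono)
qed measurable

text \<open>
  Weak convergence of \<open>w k\<close> to \<open>\<mu>\<close> against compactly supported functions extends to heat averages at
  the point \<open>x\<close>, if the averages of \<open>w k\<close> over the strictly longer times \<open>\<sigma> k\<close> stay bounded. The
  cutoffs are centred at \<open>x\<close>, so that all estimates are radial. Write \<open>I\<close> and \<open>J\<close> for the integrals of
  the truncated kernel \<open>g R\<close> against \<open>w k\<close> and \<open>\<mu>\<close>. Then
  
    \<open>d R k * I R k \<le> heat_fun (s k) (w k) x \<le> c k * (I R k + \<epsilon> R * B)\<close>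
  
  where \<open>c k\<close> and \<open>d R k\<close> tend to \<open>1\<close> along \<open>F\<close>, \<open>I R k\<close> tends to \<open>J R\<close>, and \<open>\<epsilon> R\<close> tends to \<open>0\<close> while
  \<open>J R\<close> tends to \<open>heat_measure s0 \<mu> x\<close> as \<open>R \<rightarrow> \<infinity>\<close>. Only countably many test functions are used, because
  the exceptional set of times in the definition of the initial trace depends on the test function.
\<close>
theorem heat_fun_tendsto_heat_measure:
  fixes w :: "'a \<Rightarrow> real ^ 'n \<Rightarrow> ennreal" and x :: "real ^ 'n" and s \<sigma> :: "'a \<Rightarrow> real"
  assumes \<mu>: "radon_measure \<mu>" and w[measurable]: "\<And>k. w k \<in> borel_measurable borel"
    and s0: "0 < s0" and lim_s: "(s \<longlongrightarrow> s0) F" and s_le: "\<forall>\<^sub>F k in F. s k \<le> s0"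
    and m: "s0 < m" and \<sigma>: "\<forall>\<^sub>F k in F. m \<le> \<sigma> k \<and> \<sigma> k \<le> M"
    and bound: "B < \<infinity>" "\<forall>\<^sub>F k in F. heat_fun (\<sigma> k) (w k) x \<le> B"
    and weak: "\<And>R :: nat. ((\<lambda>k. \<integral>\<^sup>+ y. w k y * ennreal (cutoff (real R) (x - y) * heat_kernel (x - y) s0) \<partial>lborel)
      \<longlongrightarrow> (\<integral>\<^sup>+ y. ennreal (cutoff (real R) (x - y) * heat_kernel (x - y) s0) \<partial>\<mu>)) F"
  shows "((\<lambda>k. heat_fun (s k) (w k) x) \<longlongrightarrow> heat_measure s0 \<mu> x) F"
proof -
  define N where "N = real CARD('n)"
  define g where "g R y = cutoff (real R) (x - y) * heat_kernel (x - y) s0" for R y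
  define I where "I R k = (\<integral>\<^sup>+ y. w k y * ennreal (g R y) \<partial>lborel)" for R k
  define J where "J R = (\<integral>\<^sup>+ y. ennreal (g R y) \<partial>\<mu>)" for R
  \<comment> \<open>\<open>c k\<close> compares the kernels at times \<open>s k \<le> s0\<close> from above on the whole space, \<open>d R k\<close> from below on the
      support of the cutoff, and \<open>\<epsilon> R\<close> bounds the kernel at time \<open>s0\<close> by the one at time \<open>\<sigma> k\<close> outside the
      ball of radius \<open>R\<close>.\<close>
  define c where "c k = (s0 / s k) powr (N / 2)" for k
  define d where "d R k = exp (- (real R + 1)\<^sup>2 / 4 * (1 / s k - 1 / s0))" for R k
  define \<epsilon> where "\<epsilon> R = (M / s0) powr (N / 2) * exp (- (real R)\<^sup>2 / 4 * (1 / s0 - 1 / m))" for R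
  have g0: "0 \<le> g R y" for R y
    by (simp add: g_def cutoff_bounds)
  have [measurable]: "g R \<in> borel_measurable borel" for R
    unfolding g_def by measurable
  have sets: "sets \<mu> = sets borel"
    using \<mu> by (simp add: radon_measure_def)
  have J: "J \<longlonglongrightarrow> heat_measure s0 \<mu> x"
    unfolding J_def g_def by (rule nn_integral_cutoff_heat_kernel_tendsto[OF sets])
  have I: "(I R \<longlongrightarrow> J R) F" for R
    unfolding I_def J_def g_def by (rule weak)
  have s_pos: "\<forall>\<^sub>F k in F. 0 < s k"
    using order_tendstoD(1)[OF lim_s s0] .
  have c: "((\<lambda>k. ennreal (c k)) \<longlongrightarrow> 1) F"
  proof -
    have "(c \<longlongrightarrow> (s0 / s0) powr (N / 2)) F"
      unfolding c_def using s0 by (intro tendsto_intros lim_s) auto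
    then show ?thesis
      using s0 tendsto_ennrealI[of c 1 F] by simp
  qed
  have d: "((\<lambda>k. ennreal (d R k)) \<longlongrightarrow> 1) F" for R
  proof -
    have "(d R \<longlongrightarrow> exp (- (real R + 1)\<^sup>2 / 4 * (1 / s0 - 1 / s0))) F"
      unfolding d_def using s0 by (intro tendsto_intros lim_s) auto
    then show ?thesis
      using tendsto_ennrealI[of "d R" 1 F] by simp
  qed
  have \<epsilon>: "(\<lambda>R. ennreal (\<epsilon> R)) \<longlonglongrightarrow> 0"
  proof -
    have "(\<lambda>R. exp (- (real R)\<^sup>2 / 4 * r)) \<longlonglongrightarrow> 0" if "0 < r" for r
      using that by real_asymp
    moreover have "0 < 1 / s0 - 1 / m"
      using s0 m by (simp add: field_simps)
    ultimately have "\<epsilon> \<longlonglongrightarrow> (M / s0) powr (N / 2) * 0"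
      unfolding \<epsilon>_def by (intro tendsto_intros)
    then show ?thesis
      using tendsto_ennrealI[of \<epsilon> 0] by simp
  qed
  have upper: "\<forall>\<^sub>F k in F. heat_fun (s k) (w k) x \<le> ennreal (c k) * (I R k + ennreal (\<epsilon> R) * B)" for R
    using s_pos s_le \<sigma> bound(2)
  proof eventually_elim
    case (elim k)
    have k: "0 < s k" "s k \<le> s0" "s0 < \<sigma> k" "m \<le> \<sigma> k" "\<sigma> k \<le> M"
      using elim m by auto
    have pt: "heat_kernel (x - y) (s k) \<le> c k * (g R y + \<epsilon> R * heat_kernel (x - y) (\<sigma> k))" for y
    proof -
      define z where "z = x - y"
      have "1 / s0 \<le> 1 / s k" using k by (simp add: field_simps)
      then have "heat_kernel z (s k) \<le> c k * 1 * heat_kernel z s0"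
        unfolding c_def using k s0
        by (subst heat_kernel_change_time[of "s k" s0])
          (auto simp: N_def intro!: mult_left_le_one_le mult_left_mono)
      moreover have "heat_kernel z s0 \<le> cutoff (real R) z * heat_kernel z s0 + \<epsilon> R * heat_kernel z (\<sigma> k)"
      proof (cases "norm z \<le> real R")
        case True
        then show ?thesis by (simp add: cutoff_eq_1 \<epsilon>_def)
      next
        case False
        have "1 / \<sigma> k \<le> 1 / m" "1 / m < 1 / s0" using k m s0 by (auto simp: field_simps)
        moreover have "(real R)\<^sup>2 \<le> (norm z)\<^sup>2" using False by (intro power_mono) auto
        ultimately have "(real R)\<^sup>2 * (1 / s0 - 1 / m) \<le> (norm z)\<^sup>2 * (1 / s0 - 1 / \<sigma> k)"
          by (intro mult_mono) auto
        then have "exp (- (norm z)\<^sup>2 / 4 * (1 / s0 - 1 / \<sigma> k)) \<le> exp (- (real R)\<^sup>2 / 4 * (1 / s0 - 1 / m))"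
          by simp
        moreover have "(\<sigma> k / s0) powr (N / 2) \<le> (M / s0) powr (N / 2)"
          using k s0 by (intro powr_mono2 divide_right_mono) (auto simp: N_def)
        ultimately have "heat_kernel z s0 \<le> \<epsilon> R * heat_kernel z (\<sigma> k)"
          unfolding \<epsilon>_def using k s0
          by (subst heat_kernel_change_time[of s0 "\<sigma> k"])
            (auto simp: N_def intro!: mult_right_mono mult_mono)
        moreover have "0 \<le> cutoff (real R) z * heat_kernel z s0"
          by (simp add: cutoff_bounds)
        ultimately show ?thesis by simp
      qed
      ultimately show ?thesis
        unfolding g_def z_def[symmetric]
        by (metis (no_types, opaque_lifting) c_def mult.right_neutral mult_left_mono order_trans powr_ge_zero)
    qed
    have "heat_fun (s k) (w k) x \<le> (\<integral>\<^sup>+ y. ennreal (c k) * (w k y * ennreal (g R y)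
        + ennreal (\<epsilon> R) * (ennreal (heat_kernel (x - y) (\<sigma> k)) * w k y)) \<partial>lborel)"
      unfolding heat_fun_lborel
    proof (rule nn_integral_mono)
      fix y
      have nn: "0 \<le> c k" "0 \<le> \<epsilon> R" by (simp_all add: c_def \<epsilon>_def)
      have "ennreal (heat_kernel (x - y) (s k)) \<le> ennreal (c k * (g R y + \<epsilon> R * heat_kernel (x - y) (\<sigma> k)))"
        by (rule ennreal_leI[OF pt])
      also have "\<dots> = ennreal (c k) * (ennreal (g R y) + ennreal (\<epsilon> R) * ennreal (heat_kernel (x - y) (\<sigma> k)))"
        using nn g0 by (simp add: ennreal_mult)
      finally have "ennreal (heat_kernel (x - y) (s k)) * w k y
          \<le> ennreal (c k) * (ennreal (g R y) + ennreal (\<epsilon> R) * ennreal (heat_kernel (x - y) (\<sigma> k))) * w k y"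
        by (rule mult_right_mono) simp
      then show "ennreal (heat_kernel (x - y) (s k)) * w k y \<le> ennreal (c k) * (w k y * ennreal (g R y)
          + ennreal (\<epsilon> R) * (ennreal (heat_kernel (x - y) (\<sigma> k)) * w k y))"
        by (simp add: algebra_simps)
    qed
    also have "\<dots> = ennreal (c k) * (I R k + ennreal (\<epsilon> R) * heat_fun (\<sigma> k) (w k) x)"
      by (simp add: nn_integral_cmult nn_integral_add I_def heat_fun_lborel)
    also have "\<dots> \<le> ennreal (c k) * (I R k + ennreal (\<epsilon> R) * B)"
      using elim by (intro mult_left_mono add_left_mono) auto
    finally show ?case .
  qed
  have lower: "\<forall>\<^sub>F k in F. ennreal (d R k) * I R k \<le> heat_fun (s k) (w k) x" for R
    using s_pos s_le
  proof eventually_elim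
    case (elim k)
    have pt: "d R k * g R y \<le> heat_kernel (x - y) (s k)" for y
    proof -
      define z where "z = x - y"
      have "d R k * (cutoff (real R) z * heat_kernel z s0) \<le> heat_kernel z (s k)"
      proof (cases "norm z < real R + 1")
        case True
        have "1 / s0 \<le> 1 / s k" using elim by (simp add: field_simps)
        moreover have "(norm z)\<^sup>2 \<le> (real R + 1)\<^sup>2" using True by (intro power_mono) auto
        ultimately have "(norm z)\<^sup>2 * (1 / s k - 1 / s0) \<le> (real R + 1)\<^sup>2 * (1 / s k - 1 / s0)"
          by (intro mult_right_mono) auto
        then have 1: "d R k \<le> exp (- (norm z)\<^sup>2 / 4 * (1 / s k - 1 / s0))"
          by (simp add: d_def)
        have 2: "1 \<le> (s0 / s k) powr (N / 2)"
          using elim by (intro ge_one_powr_ge_zero) (auto simp: N_def field_simps)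
        have "d R k * (cutoff (real R) z * heat_kernel z s0) \<le> d R k * (1 * heat_kernel z s0)"
          by (intro mult_left_mono mult_right_mono) (auto simp: cutoff_bounds d_def)
        also have "\<dots> \<le> exp (- (norm z)\<^sup>2 / 4 * (1 / s k - 1 / s0)) * heat_kernel z s0"
          using 1 by (simp add: mult_right_mono)
        also have "\<dots> \<le> (s0 / s k) powr (N / 2) * (exp (- (norm z)\<^sup>2 / 4 * (1 / s k - 1 / s0)) * heat_kernel z s0)"
          using 2 mult_right_mono[OF 2, of "exp (- (norm z)\<^sup>2 / 4 * (1 / s k - 1 / s0)) * heat_kernel z s0"]
          by simp
        also have "\<dots> = heat_kernel z (s k)"
          using heat_kernel_change_time[of "s k" s0 z] elim s0 by (simp add: N_def mult.assoc)
        finally show ?thesis .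
      qed (simp add: cutoff_eq_0)
      then show ?thesis by (simp add: g_def z_def)
    qed
    have "ennreal (d R k) * I R k = (\<integral>\<^sup>+ y. ennreal (d R k * g R y) * w k y \<partial>lborel)"
      unfolding I_def using g0
      by (subst nn_integral_cmult[symmetric]) (auto simp: ennreal_mult' d_def mult_ac intro!: nn_integral_cong)
    also have "\<dots> \<le> heat_fun (s k) (w k) x"
      unfolding heat_fun_lborel by (intro nn_integral_mono mult_right_mono ennreal_leI pt) simp
    finally show ?case .
  qed
  show ?thesis
  proof (rule order_tendstoI)
    fix a
    assume "a < heat_measure s0 \<mu> x"
    then obtain R where R: "a < J R"
      using order_tendstoD(1)[OF J] by (metis eventually_sequentially order_refl)
    have "((\<lambda>k. ennreal (d R k) * I R k) \<longlongrightarrow> 1 * J R) F"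
      by (intro tendsto_mult_ennreal d I) auto
    then have "\<forall>\<^sub>F k in F. a < ennreal (d R k) * I R k"
      using R by (intro order_tendstoD(1)) auto
    with lower[of R] show "\<forall>\<^sub>F k in F. a < heat_fun (s k) (w k) x"
      by eventually_elim (rule less_le_trans)
  next
    fix a
    assume a: "heat_measure s0 \<mu> x < a"
    have "(\<lambda>R. J R + ennreal (\<epsilon> R) * B) \<longlonglongrightarrow> heat_measure s0 \<mu> x + 0 * B"
      using bound(1) by (intro tendsto_add J tendsto_mult_ennreal \<epsilon> tendsto_const) auto
    then obtain R where R: "J R + ennreal (\<epsilon> R) * B < a"
      using a order_tendstoD(2)[of _ "heat_measure s0 \<mu> x" sequentially a]
      by (auto simp: eventually_sequentially)
    have "((\<lambda>k. ennreal (c k) * (I R k + ennreal (\<epsilon> R) * B)) \<longlongrightarrow> 1 * (J R + ennreal (\<epsilon> R) * B)) F"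
      by (intro tendsto_mult_ennreal tendsto_add c I tendsto_const) auto
    then have "\<forall>\<^sub>F k in F. ennreal (c k) * (I R k + ennreal (\<epsilon> R) * B) < a"
      using R by (intro order_tendstoD(2)) auto
    with upper[of R] show "\<forall>\<^sub>F k in F. heat_fun (s k) (w k) x < a"
      by eventually_elim (rule le_less_trans)
  qed
qed

lemma nn_integral_truncated_tendsto:
  fixes h :: "real \<Rightarrow> ennreal"
  assumes [measurable]: "h \<in> borel_measurable borel"
  shows "((\<lambda>\<tau>. \<integral>\<^sup>+ s\<in>{\<tau><..<t}. h s \<partial>lborel) \<longlongrightarrow> (\<integral>\<^sup>+ s\<in>{0<..<t}. h s \<partial>lborel)) (at_right 0)"
proof (rule tendsto_at_right_sequentially[OF zero_less_one])
  fix S :: "nat \<Rightarrow> real"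
  assume S: "\<And>n. 0 < S n" "decseq S" "S \<longlonglongrightarrow> 0"
  show "(\<lambda>n. \<integral>\<^sup>+ s\<in>{S n<..<t}. h s \<partial>lborel) \<longlonglongrightarrow> (\<integral>\<^sup>+ s\<in>{0<..<t}. h s \<partial>lborel)"
  proof (rule nn_integral_LIMSEQ)
    show "incseq (\<lambda>n s. h s * indicator {S n<..<t} s)"
      using decseqD[OF S(2)]
      by (intro monoI le_funI mult_left_mono) (auto simp: indicator_def intro: le_less_trans)
    fix s
    show "(\<lambda>n. h s * indicator {S n<..<t} s) \<longlonglongrightarrow> h s * indicator {0<..<t} s"
    proof (cases "0 < s")
      case True
      have "\<forall>\<^sub>F n in sequentially. h s * indicator {S n<..<t} s = h s * indicator {0<..<t} s"
        using order_tendstoD(2)[OF S(3) True] by eventually_elim (use True in \<open>simp add: indicator_def\<close>)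
      then show ?thesis by (rule tendsto_eventually)
    next
      case False
      have "\<not> S n < s" for n
        using S(1)[of n] False by linarith
      with False show ?thesis by simp
    qed
  qed measurable
qed

section \<open>Almost everywhere statements and Borel representatives\<close>

lemma AE_lborel_iterated:
  fixes P :: "'a::euclidean_space \<Rightarrow> 'b::euclidean_space \<Rightarrow> bool"
  assumes "AE (a, b) in lborel. P a b"
  shows "AE a in lborel. AE b in lborel. P a b"
proof -
  have "AE (a, b) in lborel \<Otimes>\<^sub>M lborel. P a b"
    using assms by (subst lborel_prod)
  from lborel_pair.AE_pair[OF this] show ?thesis
    by simp
qed

text \<open>
  Almost everywhere quantifiers over unmeasurable predicates need not commute when iterated, so
  the coordinates are exchanged on the product, before Fubini's theorem is applied.
\<close>
lemma AE_lborel_swap: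
  fixes P :: "'a::euclidean_space \<Rightarrow> 'b::euclidean_space \<Rightarrow> bool"
  assumes "AE (a, b) in lborel. P a b"
  shows "AE (b, a) in lborel. P a b"
proof -
  have "distr (lborel \<Otimes>\<^sub>M lborel) (lborel \<Otimes>\<^sub>M lborel) (\<lambda>(b :: 'b, a :: 'a). (a, b))
      = (lborel :: ('a \<times> 'b) measure)"
    by (rule trans[OF lborel_pair.distr_pair_swap[symmetric] lborel_prod])
  with assms have "AE z in distr (lborel \<Otimes>\<^sub>M lborel) (lborel \<Otimes>\<^sub>M lborel) (\<lambda>(b :: 'b, a :: 'a). (a, b)).
      case z of (a, b) \<Rightarrow> P a b"
    by (simp only:)
  then have "AE z in lborel \<Otimes>\<^sub>M lborel. case (case z of (b :: 'b, a :: 'a) \<Rightarrow> (a, b)) of (a, b) \<Rightarrow> P a b"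
    by (rule AE_distrD[rotated]) measurable
  then show ?thesis
    unfolding lborel_prod by (simp add: case_prod_beta)
qed

lemma AE_lborel_ex_between:
  fixes P :: "real \<Rightarrow> bool"
  assumes "AE t in lborel. P t" "a < b"
  obtains t where "a < t" "t < b" "P t"
proof -
  obtain N where N: "N \<in> null_sets lborel" "{t. \<not> P t} \<subseteq> N"
    using assms(1) by (auto simp: eventually_ae_filter)
  have "\<not> {a<..<b} \<subseteq> N"
  proof
    assume "{a<..<b} \<subseteq> N"
    then have "emeasure lborel {a<..<b} \<le> emeasure lborel N"
      using N(1) by (intro emeasure_mono) auto
    with N(1) assms(2) show False by auto
  qed
  then obtain t where "t \<in> {a<..<b}" "t \<notin> N" by blast
  with N(2) show ?thesis by (intro that[of t]) auto
qed

lemma AE_lborel_ex: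
  fixes P :: "'a::euclidean_space \<Rightarrow> bool"
  assumes "AE x in lborel. P x"
  obtains x where "P x"
proof -
  have "ae_filter (lborel :: 'a measure) \<noteq> bot"
    by (simp add: ae_filter_eq_bot_iff)
  from eventually_happens'[OF this assms] that show ?thesis by auto
qed

text \<open>
  Limits as \<open>t \<rightarrow> 0\<close> outside a null set of times are unique.
\<close>
lemma at_right_0_minus_null_set_neq_bot:
  assumes "Z \<in> null_sets lebesgue"
  shows "at (0 :: real) within ({0<..} - Z) \<noteq> bot"
proof -
  have "AE t in lborel. t \<notin> Z"
    using AE_not_in[OF assms] unfolding AE_completion_iff .
  have "\<exists>t\<in>{0<..} - Z. t \<noteq> 0 \<and> dist t 0 < e" if e: "0 < e" for e
  proof -
    obtain t where "0 < t" "t < e" "t \<notin> Z"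
      by (rule AE_lborel_ex_between[OF \<open>AE t in lborel. t \<notin> Z\<close> e])
    then show ?thesis by (intro bexI[of _ t]) auto
  qed
  then show ?thesis
    unfolding trivial_limit_within islimpt_approachable by blast
qed

lemma spacetime_measurable_borel_representative:
  fixes u :: "real ^ 'n \<Rightarrow> real \<Rightarrow> ennreal"
  assumes "spacetime_measurable T u"
  obtains U where "(\<lambda>(x, t). U x t) \<in> borel_measurable (borel \<Otimes>\<^sub>M borel)"
    "AE (x, t) in lborel. 0 < t \<and> ereal t < T \<longrightarrow> u x t = U x t"
    "AE t in lborel. 0 < t \<and> ereal t < T \<longrightarrow> (AE x in lborel. u x t = U x t)"
proof -
  let ?S = "{(x :: real ^ 'n, t). 0 < t \<and> ereal t < T}"
  have "Measurable.pred (borel \<Otimes>\<^sub>M borel) (\<lambda>z :: (real ^ 'n) \<times> real. 0 < snd z \<and> ereal (snd z) < T)"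
    by (cases T) simp_all
  then have S: "?S \<in> sets lebesgue"
    by (simp add: pred_def space_pair_measure borel_prod case_prod_beta')
  have "(\<lambda>z. (case z of (x, t) \<Rightarrow> u x t) * indicator ?S z) \<in> borel_measurable lebesgue"
    using assms S unfolding spacetime_measurable_def
    by (subst (asm) borel_measurable_restrict_space_iff_ennreal) auto
  then obtain g where g: "g \<in> borel_measurable lborel"
    "AE z in lborel. (case z of (x, t) \<Rightarrow> u x t) * indicator ?S z = g z"
    using completion_ex_borel_measurable by blast
  define U where "U x t = g (x, t)" for x t
  have m: "(\<lambda>(x, t). U x t) \<in> borel_measurable (borel \<Otimes>\<^sub>M borel)"
    using g(1) by (simp add: U_def borel_prod)
  have ae: "AE (x, t) in lborel. 0 < t \<and> ereal t < T \<longrightarrow> u x t = U x t"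
    using g(2) by eventually_elim (auto simp: U_def)
  have "AE t in lborel. AE x in lborel. 0 < t \<and> ereal t < T \<longrightarrow> u x t = U x t"
    by (rule AE_lborel_iterated[OF AE_lborel_swap[OF ae]])
  then have "AE t in lborel. 0 < t \<and> ereal t < T \<longrightarrow> (AE x in lborel. u x t = U x t)"
    by eventually_elim auto
  with m ae show ?thesis by (rule that)
qed

lemma heat_fun_cong_AE:
  assumes "AE y in lborel. f y = g y"
  shows "heat_fun t f x = heat_fun t g x"
  unfolding heat_fun_lborel using assms by (intro nn_integral_cong_AE) auto

text \<open>
  Fubini's theorem makes almost every time slice of the source agree with that of its
  representative, so the Duhamel integrals agree at \<^emph>\<open>every\<close> point, not only at almost every one.
\<close>
lemma duhamel_eqI:
  assumes "AE s in lborel. 0 < s \<and> ereal s < T \<longrightarrow> (AE y in lborel. f y s = g y s)"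
    and "0 \<le> \<tau>" "ereal t < T"
  shows "(\<integral>\<^sup>+ s\<in>{\<tau><..<t}. heat_fun (D * (t - s)) (\<lambda>y. f y s) x \<partial>lebesgue) = duhamel D g \<tau> t x"
  unfolding duhamel_def nn_integral_completion
proof (rule nn_integral_cong_AE)
  show "AE s in lborel. heat_fun (D * (t - s)) (\<lambda>y. f y s) x * indicator {\<tau><..<t} s
      = heat_fun (D * (t - s)) (\<lambda>y. g y s) x * indicator {\<tau><..<t} s"
    using assms(1)
  proof eventually_elim
    case (elim s)
    show ?case
    proof (cases "s \<in> {\<tau><..<t}")
      case True
      then have "ereal s < T" using assms(3) less_trans[of "ereal s" "ereal t" T] by simp
      with True elim assms(2) have "AE y in lborel. f y s = g y s" by auto
      then show ?thesis by (simp add: heat_fun_cong_AE)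
    qed simp
  qed
qed

text \<open>
  Translates between the Bochner integrals in the definition of the initial trace and
  nonnegative integrals of Borel functions. At points where \<open>W\<close> is infinite, \<open>enn2real\<close> is \<open>0\<close>; finiteness of the
  integral forces \<open>\<phi>\<close> to vanish at almost all of these points.
\<close>
lemma integral_enn2real_lebesgue:
  fixes w W :: "real ^ 'n \<Rightarrow> ennreal" and \<phi> :: "real ^ 'n \<Rightarrow> real"
  assumes [measurable]: "W \<in> borel_measurable borel" "\<phi> \<in> borel_measurable borel"
    and wW: "AE y in lborel. w y = W y" and \<phi>: "\<And>y. 0 \<le> \<phi> y"
    and fin: "(\<integral>\<^sup>+ y. W y * ennreal (\<phi> y) \<partial>lborel) < \<infinity>"
  shows "integrable lebesgue (\<lambda>y. enn2real (w y) * \<phi> y)"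
    and "(\<integral> y. enn2real (w y) * \<phi> y \<partial>lebesgue) = enn2real (\<integral>\<^sup>+ y. W y * ennreal (\<phi> y) \<partial>lborel)"
proof -
  have "AE y in lborel. W y * ennreal (\<phi> y) \<noteq> \<infinity>"
    using fin by (intro nn_integral_noteq_infinite) auto
  then have "AE y in lborel. ennreal (enn2real (W y) * \<phi> y) = W y * ennreal (\<phi> y)"
  proof eventually_elim
    case (elim y)
    show ?case
    proof (cases "W y = \<infinity>")
      case True
      then have "\<phi> y = 0"
        using elim \<phi>[of y] by (auto simp: ennreal_top_mult split: if_splits)
      then show ?thesis by simp
    next
      case False
      then show ?thesis
        using \<phi>[of y] by (simp add: ennreal_mult less_top)
    qed
  qed
  then have eq: "(\<integral>\<^sup>+ y. ennreal (enn2real (W y) * \<phi> y) \<partial>lborel) = (\<integral>\<^sup>+ y. W y * ennreal (\<phi> y) \<partial>lborel)"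
    by (rule nn_integral_cong_AE)
  have m: "(\<lambda>y. enn2real (W y) * \<phi> y) \<in> borel_measurable lebesgue"
    by (rule measurable_completion) measurable
  have ae: "AE y in lebesgue. enn2real (W y) * \<phi> y = enn2real (w y) * \<phi> y"
    unfolding AE_completion_iff using wW by eventually_elim simp
  have m': "(\<lambda>y. enn2real (w y) * \<phi> y) \<in> borel_measurable lebesgue"
    by (rule borel_measurable_AE[OF m ae])
  have int: "integrable lborel (\<lambda>y. enn2real (W y) * \<phi> y)"
    using \<phi> fin by (intro integrableI_nonneg) (auto simp: eq)
  then have "integrable lebesgue (\<lambda>y. enn2real (W y) * \<phi> y)"
    by (subst integrable_completion) auto
  then show "integrable lebesgue (\<lambda>y. enn2real (w y) * \<phi> y)"
    using integrable_cong_AE[OF m m' ae] by simp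
  have "(\<integral> y. enn2real (w y) * \<phi> y \<partial>lebesgue) = (\<integral> y. enn2real (W y) * \<phi> y \<partial>lborel)"
    using integral_cong_AE[OF m m' ae] by (simp add: integral_completion)
  also have "\<dots> = enn2real (\<integral>\<^sup>+ y. W y * ennreal (\<phi> y) \<partial>lborel)"
    using \<phi> by (subst integral_eq_nn_integral) (auto simp: eq)
  finally show "(\<integral> y. enn2real (w y) * \<phi> y \<partial>lebesgue) = enn2real (\<integral>\<^sup>+ y. W y * ennreal (\<phi> y) \<partial>lborel)" .
qed

section \<open>The linear equation with a given source\<close>

lemma AE_lborel_null_set:
  fixes P :: "'a::euclidean_space \<Rightarrow> bool"
  assumes "AE x in lborel. P x"
  obtains Z where "Z \<in> null_sets lebesgue" "\<And>x. x \<notin> Z \<Longrightarrow> P x"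
proof -
  obtain N where "N \<in> null_sets lborel" "{x. \<not> P x} \<subseteq> N"
    using assms by (auto simp: eventually_ae_filter)
  then show ?thesis
    by (intro that[of N] null_sets_completionI) auto
qed

text \<open>
  For almost every \<open>t\<close> the slice \<open>u(t)\<close> agrees almost everywhere with the representation \<open>V(t)\<close>, which is
  defined at every time. The limit of the integrals of \<open>V(t)\<close> holds along all \<open>t \<rightarrow> 0\<close>; the
  exceptional set of times is the one where \<open>u(t)\<close> and \<open>V(t)\<close> differ, and is the same for all test functions.
\<close>
theorem mild_solution_initial_trace:
  fixes u f :: "real ^ 'n \<Rightarrow> real \<Rightarrow> ennreal"
  assumes D: "0 < D" and T: "0 < T" and \<mu>: "radon_measure \<mu>"
    and f: "spacetime_measurable T f"
    and eq: "AE (x, t) in lebesgue. 0 < t \<and> ereal t < T \<longrightarrow> u x t < \<infinity> \<and>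
      u x t = heat_measure (D * t) \<mu> x
        + (\<integral>\<^sup>+ s\<in>{0<..<t}. heat_fun (D * (t - s)) (\<lambda>y. f y s) x \<partial>lebesgue)"
  shows "has_initial_trace u \<mu>"
proof -
  obtain F where F[measurable]: "(\<lambda>(x, t). F x t) \<in> borel_measurable (borel \<Otimes>\<^sub>M borel)"
    and "AE (x, t) in lborel. 0 < t \<and> ereal t < T \<longrightarrow> f x t = F x t"
    and fF: "AE t in lborel. 0 < t \<and> ereal t < T \<longrightarrow> (AE x in lborel. f x t = F x t)"
    by (rule spacetime_measurable_borel_representative[OF f])
  define V where "V x t = heat_measure (D * t) \<mu> x + duhamel D F 0 t x" for x t
  have [measurable]: "(\<lambda>(x, t). heat_measure (D * t) \<mu> x) \<in> borel_measurable (borel \<Otimes>\<^sub>M borel)"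
    by (rule borel_measurable_heat_measure[OF \<mu>])
  have [measurable]: "(\<lambda>(x, t). duhamel D F 0 t x) \<in> borel_measurable (borel \<Otimes>\<^sub>M borel)"
    by (rule borel_measurable_duhamel[OF F])
  have [measurable]: "(\<lambda>x. heat_measure (D * t) \<mu> x) \<in> borel_measurable borel" for t
    by measurable
  have [measurable]: "(\<lambda>x. duhamel D F 0 t x) \<in> borel_measurable borel" for t
    by measurable
  have ae: "AE (x, t) in lborel. 0 < t \<and> ereal t < T \<longrightarrow> u x t < \<infinity> \<and> u x t = V x t"
    using eq unfolding AE_completion_iff
    by eventually_elim (auto simp: V_def duhamel_eqI[OF fF])
  have "AE t in lborel. AE x in lborel. 0 < t \<and> ereal t < T \<longrightarrow> u x t < \<infinity> \<and> u x t = V x t"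
    by (rule AE_lborel_iterated[OF AE_lborel_swap[OF ae]])
  then have ae': "AE t in lborel. 0 < t \<and> ereal t < T \<longrightarrow> (AE x in lborel. u x t < \<infinity> \<and> u x t = V x t)"
    by eventually_elim auto
  obtain b where "0 < ereal b" and bT: "ereal b < T"
    using ereal_dense2[OF T] by blast
  then have b: "0 < b" "ereal b < T" by simp_all
  obtain t0 where t0: "0 < t0" "t0 < b" and "0 < t0 \<and> ereal t0 < T \<longrightarrow> (AE x in lborel. u x t0 < \<infinity> \<and> u x t0 = V x t0)"
    by (rule AE_lborel_ex_between[OF ae' b(1)])
  moreover have "ereal t0 < T"
    using t0 b less_trans[of "ereal t0" "ereal b" T] by simp
  ultimately have "AE x in lborel. u x t0 < \<infinity> \<and> u x t0 = V x t0"
    by simp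
  then obtain x0 where "u x0 t0 < \<infinity> \<and> u x0 t0 = V x0 t0"
    by (rule AE_lborel_ex)
  then have fin: "heat_measure (D * t0) \<mu> x0 < \<infinity>" "duhamel D F 0 t0 x0 < \<infinity>"
    by (auto simp: V_def)
  define L where "L \<psi> t = (\<integral>\<^sup>+ x. V x t * ennreal (\<psi> x) \<partial>lborel)" for \<psi> t
  have L: "(L \<psi> \<longlongrightarrow> (\<integral>\<^sup>+ x. ennreal (\<psi> x) \<partial>\<mu>)) (at_right 0)"
    if \<psi>: "\<psi> \<in> compactly_supported_continuous" "\<And>x. 0 \<le> \<psi> x" for \<psi>
  proof -
    note [measurable] = borel_measurable_compactly_supported[OF \<psi>(1)]
    have "filterlim (\<lambda>t. D * t) (at_right 0) (at_right 0)"
      using filterlim_times_pos[OF filterlim_ident D, of 0 0] by simp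
    from filterlim_compose[OF heat_measure_initial_trace[OF \<mu> \<psi> _ fin(1)] this]
    have "((\<lambda>t. \<integral>\<^sup>+ x. heat_measure (D * t) \<mu> x * ennreal (\<psi> x) \<partial>lborel) \<longlongrightarrow> (\<integral>\<^sup>+ x. ennreal (\<psi> x) \<partial>\<mu>)) (at_right 0)"
      using D t0 by simp
    from tendsto_add[OF this duhamel_initial_trace[OF F \<psi>(1) D t0(1) fin(2)]]
    show ?thesis
      by (simp add: L_def[abs_def] V_def distrib_right nn_integral_add)
  qed
  from AE_lborel_null_set[OF ae'] obtain Z where Z: "Z \<in> null_sets lebesgue"
    "\<And>t. t \<notin> Z \<Longrightarrow> 0 < t \<and> ereal t < T \<longrightarrow> (AE x in lborel. u x t < \<infinity> \<and> u x t = V x t)"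
    by blast
  show ?thesis
    unfolding has_initial_trace_def
  proof (intro ballI bexI[OF _ Z(1)])
    fix \<phi> :: "real ^ 'n \<Rightarrow> real"
    assume \<phi>: "\<phi> \<in> compactly_supported_continuous"
    let ?F = "at (0 :: real) within ({0<..} - Z)"
    define \<phi>p where "\<phi>p x = max 0 (\<phi> x)" for x
    define \<phi>m where "\<phi>m x = max 0 (- \<phi> x)" for x
    define \<phi>a where "\<phi>a x = \<bar>\<phi> x\<bar>" for x
    have cc: "\<phi>p \<in> compactly_supported_continuous" "\<phi>m \<in> compactly_supported_continuous"
      "\<phi>a \<in> compactly_supported_continuous"
      unfolding \<phi>p_def \<phi>m_def \<phi>a_def
      by (intro compactly_supported_compose[OF \<phi>, of "max 0"]
          compactly_supported_compose[OF \<phi>, of "\<lambda>r. max 0 (- r)"]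
          compactly_supported_compose[OF \<phi>, of abs] continuous_intros; simp)+
    have nn: "0 \<le> \<phi>p x" "0 \<le> \<phi>m x" "0 \<le> \<phi>a x" for x
      by (auto simp: \<phi>p_def \<phi>m_def \<phi>a_def)
    have split: "\<phi> x = \<phi>p x - \<phi>m x" for x
      by (simp add: \<phi>p_def \<phi>m_def)
    note [measurable] = cc[THEN borel_measurable_compactly_supported]
    have F_le: "?F \<le> at_right 0"
      by (rule at_le) auto
    have good: "\<forall>\<^sub>F t in ?F. t \<notin> Z \<and> 0 < t \<and> ereal t < T"
    proof -
      have "\<forall>\<^sub>F t in ?F. t \<in> {0<..} - Z"
        by (rule eventually_at_topological[THEN iffD2]) auto
      moreover have "\<forall>\<^sub>F t in ?F. t < b"
        by (rule order_tendstoD(2)[OF tendsto_ident_at b(1)])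
      ultimately show ?thesis
      proof eventually_elim
        case (elim t)
        then show ?case
          using less_trans[of "ereal t" "ereal b" T] b(2) by simp
      qed
    qed
    have lim: "((\<lambda>t. enn2real (L \<psi> t)) \<longlongrightarrow> (\<integral> x. \<psi> x \<partial>\<mu>)) ?F" and
      fin: "\<forall>\<^sub>F t in ?F. L \<psi> t < \<infinity>"
      if \<psi>: "\<psi> \<in> compactly_supported_continuous" "\<And>x. 0 \<le> \<psi> x" for \<psi>
    proof -
      have 1: "(L \<psi> \<longlongrightarrow> (\<integral>\<^sup>+ x. ennreal (\<psi> x) \<partial>\<mu>)) ?F"
        by (rule tendsto_mono[OF F_le L[OF \<psi>]])
      have "(\<integral>\<^sup>+ x. ennreal (\<psi> x) \<partial>\<mu>) = ennreal (\<integral> x. \<psi> x \<partial>\<mu>)"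
        using \<psi> integrable_radon_compactly_supported[OF \<mu> \<psi>(1)] by (intro nn_integral_eq_integral) auto
      with 1 have 2: "(L \<psi> \<longlongrightarrow> ennreal (\<integral> x. \<psi> x \<partial>\<mu>)) ?F" by simp
      from \<psi>(2) tendsto_enn2real[OF 2] show "((\<lambda>t. enn2real (L \<psi> t)) \<longlongrightarrow> (\<integral> x. \<psi> x \<partial>\<mu>)) ?F"
        by (simp add: integral_nonneg_AE)
      show "\<forall>\<^sub>F t in ?F. L \<psi> t < \<infinity>"
        by (rule order_tendstoD(2)[OF 2]) simp
    qed
    have "\<forall>\<^sub>F t in ?F. (\<integral>\<^sup>+ y. u y t * ennreal \<bar>\<phi> y\<bar> \<partial>lebesgue) < \<infinity>"
      using good fin[OF cc(3) nn(3)]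
    proof eventually_elim
      case (elim t)
      then have "AE x in lborel. u x t < \<infinity> \<and> u x t = V x t"
        using Z(2) by blast
      then have "(\<integral>\<^sup>+ y. u y t * ennreal \<bar>\<phi> y\<bar> \<partial>lborel) = L \<phi>a t"
        unfolding L_def \<phi>a_def by (intro nn_integral_cong_AE) auto
      with elim show ?case
        by (simp add: nn_integral_completion)
    qed
    moreover have "((\<lambda>t. \<integral> y. enn2real (u y t) * \<phi> y \<partial>lebesgue) \<longlongrightarrow> (\<integral> y. \<phi> y \<partial>\<mu>)) ?F"
    proof -
      have "((\<lambda>t. enn2real (L \<phi>p t) - enn2real (L \<phi>m t)) \<longlongrightarrow> (\<integral> y. \<phi>p y \<partial>\<mu>) - (\<integral> y. \<phi>m y \<partial>\<mu>)) ?F"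
        by (intro tendsto_diff lim cc nn)
      also have "(\<integral> y. \<phi>p y \<partial>\<mu>) - (\<integral> y. \<phi>m y \<partial>\<mu>) = (\<integral> y. \<phi> y \<partial>\<mu>)"
        using integrable_radon_compactly_supported[OF \<mu>] cc by (simp add: split)
      finally have "((\<lambda>t. enn2real (L \<phi>p t) - enn2real (L \<phi>m t)) \<longlongrightarrow> (\<integral> y. \<phi> y \<partial>\<mu>)) ?F" .
      moreover have "\<forall>\<^sub>F t in ?F. enn2real (L \<phi>p t) - enn2real (L \<phi>m t) = (\<integral> y. enn2real (u y t) * \<phi> y \<partial>lebesgue)"
        using good fin[OF cc(1) nn(1)] fin[OF cc(2) nn(2)]
      proof eventually_elim
        case (elim t)
        have [measurable]: "(\<lambda>y. V y t) \<in> borel_measurable borel"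
          unfolding V_def by measurable
        have "AE y in lborel. u y t = V y t"
          using Z(2)[of t] elim by auto
        note int = integral_enn2real_lebesgue[OF _ _ this]
        show ?case
          using int[of \<phi>p] int[of \<phi>m] elim nn
          by (simp add: split right_diff_distrib L_def)
      qed
      ultimately show ?thesis
        by (rule Lim_transform_eventually)
    qed
    ultimately show "(\<forall>\<^sub>F t in ?F. (\<integral>\<^sup>+ y. u y t * ennreal \<bar>\<phi> y\<bar> \<partial>lebesgue) < \<infinity>)
      \<and> ((\<lambda>t. \<integral> y. enn2real (u y t) * \<phi> y \<partial>lebesgue) \<longlongrightarrow> (\<integral> y. \<phi> y \<partial>\<mu>)) ?F"
      by blast
  qed
qed

text \<open>
  The identity between times \<open>\<tau>\<close> and \<open>t\<close> is available for almost every triple \<open>(x, \<tau>, t)\<close>. It is reordered so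
  that \<open>x\<close> is fixed first, then \<open>t\<close>, and finally \<open>\<tau>\<close> tends to \<open>0\<close> outside a null set; this order also
  allows a second time \<open>t' > t\<close> to be chosen for the same \<open>x\<close>, whose identity provides the bound
  needed in \<open>heat_fun_tendsto_heat_measure\<close>.
\<close>
theorem mild_solution_of_initial_trace:
  fixes u f :: "real ^ 'n \<Rightarrow> real \<Rightarrow> ennreal"
  assumes D: "0 < D" and \<mu>: "radon_measure \<mu>"
    and u: "spacetime_measurable T u" and f: "spacetime_measurable T f"
    and eq: "AE (x, \<tau>, t) in lebesgue. 0 < \<tau> \<and> \<tau> < t \<and> ereal t < T \<longrightarrow> u x t < \<infinity> \<and>
      u x t = heat_fun (D * (t - \<tau>)) (\<lambda>y. u y \<tau>) x
        + (\<integral>\<^sup>+ s\<in>{\<tau><..<t}. heat_fun (D * (t - s)) (\<lambda>y. f y s) x \<partial>lebesgue)"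
    and trace: "has_initial_trace u \<mu>"
  shows "AE (x, t) in lebesgue. 0 < t \<and> ereal t < T \<longrightarrow> u x t < \<infinity> \<and>
      u x t = heat_measure (D * t) \<mu> x
        + (\<integral>\<^sup>+ s\<in>{0<..<t}. heat_fun (D * (t - s)) (\<lambda>y. f y s) x \<partial>lebesgue)"
proof -
  obtain U where U[measurable]: "(\<lambda>(x, t). U x t) \<in> borel_measurable (borel \<Otimes>\<^sub>M borel)"
    and uU: "AE (x, t) in lborel. 0 < t \<and> ereal t < T \<longrightarrow> u x t = U x t"
    and uU': "AE t in lborel. 0 < t \<and> ereal t < T \<longrightarrow> (AE x in lborel. u x t = U x t)"
    by (rule spacetime_measurable_borel_representative[OF u])
  obtain F where F[measurable]: "(\<lambda>(x, t). F x t) \<in> borel_measurable (borel \<Otimes>\<^sub>M borel)"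
    and "AE (x, t) in lborel. 0 < t \<and> ereal t < T \<longrightarrow> f x t = F x t"
    and fF: "AE t in lborel. 0 < t \<and> ereal t < T \<longrightarrow> (AE x in lborel. f x t = F x t)"
    by (rule spacetime_measurable_borel_representative[OF f])
  define mild where "mild x t \<tau> \<longleftrightarrow> (0 < \<tau> \<and> \<tau> < t \<longrightarrow> U x t < \<infinity> \<and>
      U x t = heat_fun (D * (t - \<tau>)) (\<lambda>y. U y \<tau>) x + duhamel D F \<tau> t x)" for x t \<tau>
  have "AE x in lborel. AE (\<tau>, t) in lborel. 0 < \<tau> \<and> \<tau> < t \<and> ereal t < T \<longrightarrow> u x t < \<infinity> \<and>
      u x t = heat_fun (D * (t - \<tau>)) (\<lambda>y. u y \<tau>) x + duhamel D F \<tau> t x"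
  proof -
    have "AE (x, \<tau>, t) in lborel. 0 < \<tau> \<and> \<tau> < t \<and> ereal t < T \<longrightarrow> u x t < \<infinity> \<and>
      u x t = heat_fun (D * (t - \<tau>)) (\<lambda>y. u y \<tau>) x + duhamel D F \<tau> t x"
      using eq unfolding AE_completion_iff
      by eventually_elim (auto simp: duhamel_eqI[OF fF])
    then have "AE (x, r) in lborel. case r of (\<tau>, t) \<Rightarrow> 0 < \<tau> \<and> \<tau> < t \<and> ereal t < T \<longrightarrow> u x t < \<infinity> \<and>
      u x t = heat_fun (D * (t - \<tau>)) (\<lambda>y. u y \<tau>) x + duhamel D F \<tau> t x"
      by (simp add: case_prod_beta')
    then show ?thesis
      by (rule AE_lborel_iterated)
  qed
  then have "AE x in lborel. AE t in lborel. 0 < t \<and> ereal t < T \<longrightarrow> (AE \<tau> in lborel. mild x t \<tau>)"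
    using AE_lborel_iterated[OF uU]
  proof eventually_elim
    case (elim x)
    from AE_lborel_iterated[OF AE_lborel_swap[OF elim(1)]] elim(2) show ?case
    proof eventually_elim
      case (elim t)
      show ?case
      proof
        assume t: "0 < t \<and> ereal t < T"
        show "AE \<tau> in lborel. mild x t \<tau>"
          using elim(1) uU'
        proof eventually_elim
          case (elim \<tau>)
          show ?case
            unfolding mild_def
          proof
            assume \<tau>: "0 < \<tau> \<and> \<tau> < t"
            then have "ereal \<tau> < T" using t less_trans[of "ereal \<tau>" "ereal t" T] by simp
            with elim(2) \<tau> have "heat_fun (D * (t - \<tau>)) (\<lambda>y. u y \<tau>) x = heat_fun (D * (t - \<tau>)) (\<lambda>y. U y \<tau>) x"
              by (intro heat_fun_cong_AE) auto
            with elim(1) \<tau> t \<open>0 < t \<and> ereal t < T \<longrightarrow> u x t = U x t\<close>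
            show "U x t < \<infinity> \<and> U x t = heat_fun (D * (t - \<tau>)) (\<lambda>y. U y \<tau>) x + duhamel D F \<tau> t x"
              by auto
          qed
        qed
      qed
    qed
  qed
  then have "AE x in lborel. AE t in lborel. 0 < t \<and> ereal t < T \<longrightarrow>
      U x t < \<infinity> \<and> U x t = heat_measure (D * t) \<mu> x + duhamel D F 0 t x"
  proof eventually_elim
    case (elim x)
    note milds = elim
    from milds show ?case
    proof eventually_elim
      case (elim t)
      show ?case
      proof
        assume t: "0 < t \<and> ereal t < T"
        with elim have mild_t: "AE \<tau> in lborel. mild x t \<tau>" by simp
        obtain b where b: "t < b" "ereal b < T"
          using ereal_dense2[of "ereal t" T] t by auto
        obtain t' where t': "t < t'" "t' < b" "0 < t' \<and> ereal t' < T \<longrightarrow> (AE \<tau> in lborel. mild x t' \<tau>)"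
          by (rule AE_lborel_ex_between[OF milds b(1)])
        moreover have "ereal t' < T"
          using t' b less_trans[of "ereal t'" "ereal b" T] by simp
        ultimately have mild_t': "AE \<tau> in lborel. mild x t' \<tau>" using t by simp
        define g where "g R y = cutoff (real R) (x - y) * heat_kernel (x - y) (D * t)" for R y
        have g: "g R \<in> compactly_supported_continuous" "0 \<le> g R y" for R y
          using cutoff_heat_kernel_compactly_supported[of "D * t" R x] D t
          by (simp_all add: g_def[abs_def] cutoff_bounds)
        note [measurable] = g(1)[THEN borel_measurable_compactly_supported]
        have "\<forall>R. \<exists>Z. Z \<in> null_sets lebesgue \<and>
          (\<forall>\<^sub>F t in at 0 within ({0<..} - Z). (\<integral>\<^sup>+ y. u y t * ennreal \<bar>g R y\<bar> \<partial>lebesgue) < \<infinity>) \<and>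
          ((\<lambda>t. \<integral>y. enn2real (u y t) * g R y \<partial>lebesgue) \<longlongrightarrow> (\<integral>y. g R y \<partial>\<mu>)) (at 0 within ({0<..} - Z))"
          using trace g(1) unfolding has_initial_trace_def by blast
        from choice[OF this] obtain ZR where "\<forall>R. ZR R \<in> null_sets lebesgue \<and>
          (\<forall>\<^sub>F t in at 0 within ({0<..} - ZR R). (\<integral>\<^sup>+ y. u y t * ennreal \<bar>g R y\<bar> \<partial>lebesgue) < \<infinity>) \<and>
          ((\<lambda>t. \<integral>y. enn2real (u y t) * g R y \<partial>lebesgue) \<longlongrightarrow> (\<integral>y. g R y \<partial>\<mu>)) (at 0 within ({0<..} - ZR R))"
          by (rule exE)
        then have ZR: "\<And>R. ZR R \<in> null_sets lebesgue"
          "\<And>R. \<forall>\<^sub>F t in at 0 within ({0<..} - ZR R). (\<integral>\<^sup>+ y. u y t * ennreal \<bar>g R y\<bar> \<partial>lebesgue) < \<infinity>"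
          "\<And>R. ((\<lambda>t. \<integral>y. enn2real (u y t) * g R y \<partial>lebesgue) \<longlongrightarrow> (\<integral>y. g R y \<partial>\<mu>)) (at 0 within ({0<..} - ZR R))"
          by simp_all
        have "AE \<tau> in lborel. (0 < \<tau> \<and> ereal \<tau> < T \<longrightarrow> (AE y in lborel. u y \<tau> = U y \<tau>)) \<and> mild x t \<tau> \<and> mild x t' \<tau>"
          using uU' mild_t mild_t' by eventually_elim auto
        from AE_lborel_null_set[OF this] obtain Z0 where Z0: "Z0 \<in> null_sets lebesgue" "\<And>\<tau>. \<tau> \<notin> Z0 \<Longrightarrow>
            (0 < \<tau> \<and> ereal \<tau> < T \<longrightarrow> (AE y in lborel. u y \<tau> = U y \<tau>)) \<and> mild x t \<tau> \<and> mild x t' \<tau>"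
          by blast
        \<comment> \<open>One exceptional set of times for each of the countably many cutoff radii, together with the
            times at which one of the two identities or the choice of representative fails.\<close>
        define Z where "Z = Z0 \<union> (\<Union>R. ZR R)"
        have Z: "Z \<in> null_sets lebesgue"
          unfolding Z_def using Z0(1) ZR(1) by auto
        define \<F> where "\<F> = at (0 :: real) within ({0<..} - Z)"
        have nontriv: "\<F> \<noteq> bot"
          unfolding \<F>_def by (rule at_right_0_minus_null_set_neq_bot[OF Z])
        have F_le: "\<F> \<le> at_right 0" and F_le': "\<F> \<le> at 0 within ({0<..} - ZR R)" for R
          unfolding \<F>_def Z_def by (intro at_le; blast)+
        have conv0: "((\<lambda>\<tau>. \<tau>) \<longlongrightarrow> 0) \<F>"
          unfolding \<F>_def by (rule tendsto_ident_at)
        have good: "\<forall>\<^sub>F \<tau> in \<F>. 0 < \<tau> \<and> \<tau> < t \<and> \<tau> < (t' - t) / 2 \<and> \<tau> \<notin> Z0"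
        proof -
          have "\<forall>\<^sub>F \<tau> in \<F>. \<tau> \<in> {0<..} - Z"
            unfolding \<F>_def by (rule eventually_at_topological[THEN iffD2]) auto
          moreover have "\<forall>\<^sub>F \<tau> in \<F>. \<tau> < t" "\<forall>\<^sub>F \<tau> in \<F>. \<tau> < (t' - t) / 2"
            using t t' by (intro order_tendstoD(2)[OF conv0]; simp)+
          ultimately show ?thesis
            by eventually_elim (auto simp: Z_def)
        qed
        have ident: "\<forall>\<^sub>F \<tau> in \<F>. U x t < \<infinity> \<and> U x t = heat_fun (D * (t - \<tau>)) (\<lambda>y. U y \<tau>) x + duhamel D F \<tau> t x"
          using good by eventually_elim (use Z0(2) in \<open>auto simp: mild_def\<close>)
        have ident': "\<forall>\<^sub>F \<tau> in \<F>. U x t' < \<infinity> \<and> U x t' = heat_fun (D * (t' - \<tau>)) (\<lambda>y. U y \<tau>) x + duhamel D F \<tau> t' x"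
          using good
        proof eventually_elim
          case (elim \<tau>)
          then have "mild x t' \<tau>" "0 < \<tau> \<and> \<tau> < t'"
            using Z0(2) t'(1) by auto
          then show ?case
            unfolding mild_def by blast
        qed
        have weak: "((\<lambda>\<tau>. \<integral>\<^sup>+ y. U y \<tau> * ennreal (g R y) \<partial>lborel) \<longlongrightarrow> (\<integral>\<^sup>+ y. ennreal (g R y) \<partial>\<mu>)) \<F>" for R
        proof -
          have "(\<integral>\<^sup>+ y. ennreal (g R y) \<partial>\<mu>) = ennreal (\<integral> y. g R y \<partial>\<mu>)"
            using g integrable_radon_compactly_supported[OF \<mu> g(1)] by (intro nn_integral_eq_integral) auto
          moreover have "((\<lambda>\<tau>. ennreal (\<integral>y. enn2real (u y \<tau>) * g R y \<partial>lebesgue)) \<longlongrightarrow> ennreal (\<integral> y. g R y \<partial>\<mu>)) \<F>"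
            by (intro tendsto_ennrealI tendsto_mono[OF F_le' ZR(3)])
          moreover have "\<forall>\<^sub>F \<tau> in \<F>. ennreal (\<integral>y. enn2real (u y \<tau>) * g R y \<partial>lebesgue) = (\<integral>\<^sup>+ y. U y \<tau> * ennreal (g R y) \<partial>lborel)"
            using good filter_leD[OF F_le' ZR(2)[of R]]
          proof eventually_elim
            case (elim \<tau>)
            have "ereal \<tau> < T"
              using elim t less_trans[of "ereal \<tau>" "ereal t" T] by simp
            then have ae: "AE y in lborel. u y \<tau> = U y \<tau>"
              using Z0(2)[of \<tau>] elim by auto
            have "(\<integral>\<^sup>+ y. u y \<tau> * ennreal \<bar>g R y\<bar> \<partial>lebesgue) = (\<integral>\<^sup>+ y. U y \<tau> * ennreal (g R y) \<partial>lborel)"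
              unfolding nn_integral_completion using ae g(2) by (intro nn_integral_cong_AE) auto
            with elim have "(\<integral>\<^sup>+ y. U y \<tau> * ennreal (g R y) \<partial>lborel) < \<infinity>" by simp
            with integral_enn2real_lebesgue(2)[OF _ _ ae, of "g R"] g(2) show ?case
              by simp
          qed
          ultimately show ?thesis
            using Lim_transform_eventually by simp
        qed
        have fin': "U x t' < \<infinity>"
          using eventually_happens'[OF nontriv ident'] by blast
        have "((\<lambda>\<tau>. heat_fun (D * (t - \<tau>)) (\<lambda>y. U y \<tau>) x) \<longlongrightarrow> heat_measure (D * t) \<mu> x) \<F>"
        proof (rule heat_fun_tendsto_heat_measure[where m = "D * ((t + t') / 2)" and \<sigma> = "\<lambda>\<tau>. D * (t' - \<tau>)"
              and M = "D * t'" and B = "U x t'", OF \<mu>])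
          show "((\<lambda>\<tau>. D * (t - \<tau>)) \<longlongrightarrow> D * t) \<F>"
            using tendsto_mult[OF tendsto_const tendsto_diff[OF tendsto_const conv0], of D t] by simp
          show "\<forall>\<^sub>F \<tau> in \<F>. D * (t - \<tau>) \<le> D * t"
            using good by eventually_elim (use D in auto)
          show "\<forall>\<^sub>F \<tau> in \<F>. D * ((t + t') / 2) \<le> D * (t' - \<tau>) \<and> D * (t' - \<tau>) \<le> D * t'"
            using good by eventually_elim (use D in \<open>auto intro!: mult_left_mono\<close>)
          show "\<forall>\<^sub>F \<tau> in \<F>. heat_fun (D * (t' - \<tau>)) (\<lambda>y. U y \<tau>) x \<le> U x t'"
            using ident' by eventually_elim simp
        qed (use D t t' fin' weak in \<open>auto simp: g_def\<close>)
        moreover have "((\<lambda>\<tau>. duhamel D F \<tau> t x) \<longlongrightarrow> duhamel D F 0 t x) \<F>"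
          unfolding duhamel_def by (intro tendsto_mono[OF F_le nn_integral_truncated_tendsto]) measurable
        ultimately have "((\<lambda>\<tau>. heat_fun (D * (t - \<tau>)) (\<lambda>y. U y \<tau>) x + duhamel D F \<tau> t x)
            \<longlongrightarrow> heat_measure (D * t) \<mu> x + duhamel D F 0 t x) \<F>"
          by (rule tendsto_add)
        moreover have "((\<lambda>\<tau>. heat_fun (D * (t - \<tau>)) (\<lambda>y. U y \<tau>) x + duhamel D F \<tau> t x) \<longlongrightarrow> U x t) \<F>"
          by (rule tendsto_eventually) (use ident in eventually_elim, simp)
        ultimately have "U x t = heat_measure (D * t) \<mu> x + duhamel D F 0 t x"
          using tendsto_unique[OF nontriv] by blast
        moreover have "U x t < \<infinity>"
          using eventually_happens'[OF nontriv ident] by blast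
        ultimately show "U x t < \<infinity> \<and> U x t = heat_measure (D * t) \<mu> x + duhamel D F 0 t x" by blast
      qed
    qed
  qed
  then have iter: "AE x in lborel. AE t in lborel. case (x, t) of (x, t) \<Rightarrow> 0 < t \<and> ereal t < T \<longrightarrow>
      U x t < \<infinity> \<and> U x t = heat_measure (D * t) \<mu> x + duhamel D F 0 t x"
    by simp
  have "AE (x, t) in lborel \<Otimes>\<^sub>M lborel. 0 < t \<and> ereal t < T \<longrightarrow>
      U x t < \<infinity> \<and> U x t = heat_measure (D * t) \<mu> x + duhamel D F 0 t x"
  proof (rule lborel_pair.AE_pair_measure[OF _ iter])
    have [measurable]: "(\<lambda>(x, t). heat_measure (D * t) \<mu> x) \<in> borel_measurable (borel \<Otimes>\<^sub>M borel)"
      by (rule borel_measurable_heat_measure[OF \<mu>])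
    have [measurable]: "(\<lambda>(x, t). duhamel D F 0 t x) \<in> borel_measurable (borel \<Otimes>\<^sub>M borel)"
      by (rule borel_measurable_duhamel[OF F])
    have [measurable]: "Measurable.pred borel (\<lambda>t. ereal t < T)"
      by (cases T) simp_all
    show "{z \<in> space (lborel \<Otimes>\<^sub>M lborel). case z of (x, t) \<Rightarrow> 0 < t \<and> ereal t < T \<longrightarrow>
      U x t < \<infinity> \<and> U x t = heat_measure (D * t) \<mu> x + duhamel D F 0 t x} \<in> sets (lborel \<Otimes>\<^sub>M lborel)"
      by measurable
  qed
  then have "AE (x, t) in lborel. 0 < t \<and> ereal t < T \<longrightarrow>
      U x t < \<infinity> \<and> U x t = heat_measure (D * t) \<mu> x + duhamel D F 0 t x"
    unfolding lborel_prod .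
  with uU show ?thesis
    unfolding AE_completion_iff
    by eventually_elim (auto simp: duhamel_eqI[OF fF])
qed

section \<open>The system\<close>

lemma spacetime_measurable_ennreal_powr:
  assumes "spacetime_measurable T v"
  shows "spacetime_measurable T (\<lambda>x t. ennreal_powr (v x t) p)"
proof -
  have "(\<lambda>a. ennreal_powr a p) \<in> borel_measurable borel"
    unfolding ennreal_powr_def by measurable
  from measurable_compose[OF assms[unfolded spacetime_measurable_def] this] show ?thesis
    by (simp add: spacetime_measurable_def case_prod_beta')
qed

theorem theorem1p2:
  fixes D1 D2 p q :: real and T :: ereal
    and \<mu> \<nu> :: "(real ^ 'n) measure"
    and u v :: "real ^ 'n \<Rightarrow> real \<Rightarrow> ennreal"
  assumes "D1 > 0" and "D2 > 0"
    and "0 < p" and "p \<le> q" and "p * q > 1"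
    and "radon_measure \<mu>" and "radon_measure \<nu>"
    and "0 < T"
  shows "(solution_S_with_I D1 D2 p q T \<mu> \<nu> u v \<longrightarrow>
            has_initial_trace u \<mu> \<and> has_initial_trace v \<nu>) \<and>
         (solution_S D1 D2 p q T u v \<and> has_initial_trace u \<mu> \<and> has_initial_trace v \<nu> \<longrightarrow>
            solution_S_with_I D1 D2 p q T \<mu> \<nu> u v)"
proof (intro conjI impI)
  assume sol: "solution_S_with_I D1 D2 p q T \<mu> \<nu> u v"
  then have m: "spacetime_measurable T u" "spacetime_measurable T v"
    by (simp_all add: solution_S_with_I_def)
  show "has_initial_trace u \<mu>"
    by (rule mild_solution_initial_trace[where f = "\<lambda>y s. ennreal_powr (v y s) p",
          OF assms(1) assms(8) assms(6) spacetime_measurable_ennreal_powr[OF m(2)]])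
      (use sol in \<open>auto simp: solution_S_with_I_def elim!: eventually_mono\<close>)
  show "has_initial_trace v \<nu>"
    by (rule mild_solution_initial_trace[where f = "\<lambda>y s. ennreal_powr (u y s) q",
          OF assms(2) assms(8) assms(7) spacetime_measurable_ennreal_powr[OF m(1)]])
      (use sol in \<open>auto simp: solution_S_with_I_def elim!: eventually_mono\<close>)
next
  assume sol: "solution_S D1 D2 p q T u v \<and> has_initial_trace u \<mu> \<and> has_initial_trace v \<nu>"
  then have m: "spacetime_measurable T u" "spacetime_measurable T v"
    by (simp_all add: solution_S_def)
  have "AE (x, t) in lebesgue. 0 < t \<and> ereal t < T \<longrightarrow> u x t < \<infinity> \<and> u x t = heat_measure (D1 * t) \<mu> x
      + (\<integral>\<^sup>+ s\<in>{0<..<t}. heat_fun (D1 * (t - s)) (\<lambda>y. ennreal_powr (v y s) p) x \<partial>lebesgue)"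
    by (rule mild_solution_of_initial_trace[where f = "\<lambda>y s. ennreal_powr (v y s) p",
          OF assms(1) assms(6) m(1) spacetime_measurable_ennreal_powr[OF m(2)]])
      (use sol in \<open>auto simp: solution_S_def elim!: eventually_mono\<close>)
  moreover have "AE (x, t) in lebesgue. 0 < t \<and> ereal t < T \<longrightarrow> v x t < \<infinity> \<and> v x t = heat_measure (D2 * t) \<nu> x
      + (\<integral>\<^sup>+ s\<in>{0<..<t}. heat_fun (D2 * (t - s)) (\<lambda>y. ennreal_powr (u y s) q) x \<partial>lebesgue)"
    by (rule mild_solution_of_initial_trace[where f = "\<lambda>y s. ennreal_powr (u y s) q",
          OF assms(2) assms(7) m(2) spacetime_measurable_ennreal_powr[OF m(1)]])
      (use sol in \<open>auto simp: solution_S_def elim!: eventually_mono\<close>)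
  ultimately have "AE (x, t) in lebesgue. 0 < t \<and> ereal t < T \<longrightarrow> u x t < \<infinity> \<and> v x t < \<infinity> \<and>
      u x t = heat_measure (D1 * t) \<mu> x
      + (\<integral>\<^sup>+ s\<in>{0<..<t}. heat_fun (D1 * (t - s)) (\<lambda>y. ennreal_powr (v y s) p) x \<partial>lebesgue) \<and>
      v x t = heat_measure (D2 * t) \<nu> x
      + (\<integral>\<^sup>+ s\<in>{0<..<t}. heat_fun (D2 * (t - s)) (\<lambda>y. ennreal_powr (u y s) q) x \<partial>lebesgue)"
    by eventually_elim auto
  with m show "solution_S_with_I D1 D2 p q T \<mu> \<nu> u v"
    by (simp add: solution_S_with_I_def)
qed

end
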